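(* Let $\vec\lambda=(\lambda_1,\dots,\lambda_k)$ be any sequence of dominant minuscule weights of $\mathrm{SL}_n$ and let $\vec\mu\in P_{\vec\lambda}$. Then there exists a coherent web with boundary $\vec\lambda$ whose associated path is $\vec\mu$.
   Context: Weights of $\mathrm{SL}_n$: $\mathbb{Z}^n/\mathbb{Z}(1,\dots,1)$, $\omega_i=e_1+\dots+e_i$ ($\omega_0=0$, indices mod $n$), $W=S_n$, order $\mu\le\nu$ iff $\nu-\mu$ is a nonnegative integer combination of positive roots; dominant minuscule weights are $\omega_1,\dots,\omega_{n-1}$. A web is a finite directed planar graph in a disk with a marked boundary point, internal vertices trivalent, other vertices univalent on the boundary circle, edges labelled by $a\in\{1,\dots,n-1\}$ (reversing orientation replaces $a$ by $n-a$), with incoming labels summing to outgoing labels mod $n$ at each trivalent vertex; its boundary is the sequence of labels $\omega_a$ of boundary edges oriented outward, read clockwise from the marked point. Dual diskoid $D(w)$: planar dual graph, edges carrying the labels of the crossed web edges, oriented so (web edge, dual edge) is positively oriented; marked vertex $\bullet$ = face containing the marked point; external vertices $v_0=\bullet,\dots,v_k=\bullet$ = faces touching the boundary, clockwise. Path length: an edge labelled $a$ contributes $\omega_a$ traversed along its direction and $\omega_{n-a}$ against it. Geodesic: path of minimal length between its endpoints; $(a,b)$ has coherent geodesics if all geodesics between them have the same length $d(a,b)$. $w$ is coherent if (1) every pair $(\bullet,v)$ has coherent geodesics; (2) every internal vertex of $D(w)$ lies on a geodesic from $\bullet$ to an external vertex; (3) for every edge $a\to b$ of $D(w)$ with label $\gamma$,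 $d(\bullet,b)-d(\bullet,a)\in W\gamma$. Its associated path is $(d(\bullet,v_0),\dots,d(\bullet,v_k))$. $P_{\vec\lambda}$: sequences $(\mu_0,\dots,\mu_k)$ of dominant weights with $\mu_0=\mu_k=0$ and $\mu_i-\mu_{i-1}\in W\lambda_i$.
   Formalization: Dual edges are oriented so that (dual edge, web edge) is positively oriented, opposite to the stated convention; with that one and clockwise outward boundary labels the claim fails, e.g. for SL_3, λ=(ω_1,ω_2), μ=(0,ω_1,0), where condition (3) would need −ω_1∈Wω_1. *)

theory Defs
  imports "HOL-Combinatorics.Permutations"
begin

section \<open>Weights of SL_n\<close>

text \<open>A weight of SL_n is represented by an integer vector x :: nat => int, of which only
the coordinates x 1, ..., x n (the coefficients of e_1, ..., e_n) matter; two vectors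
represent the same weight iff they differ by a constant on {1..n}
(weights = Z^n / Z(1,...,1)).\<close>

type_synonym weight = "nat \<Rightarrow> int"

definition wt_eq :: "nat \<Rightarrow> weight \<Rightarrow> weight \<Rightarrow> bool" where
  "wt_eq n x y \<longleftrightarrow> (\<exists>c::int. \<forall>i\<in>{1..n}. x i = y i + c)"

definition wt_zero :: weight where
  "wt_zero = (\<lambda>_. 0)"

definition wt_diff :: "weight \<Rightarrow> weight \<Rightarrow> weight" where
  "wt_diff x y = (\<lambda>i. x i - y i)"

text \<open>Fundamental weight omega_a = e_1 + ... + e_a, indices taken mod n (omega_0 = 0).\<close>
definition omega :: "nat \<Rightarrow> nat \<Rightarrow> weight" where
  "omega n a = (\<lambda>i. if 1 \<le> i \<and> i \<le> a mod n then 1 else 0)"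

text \<open>Dominance order: mu <= nu iff nu - mu is a nonnegative integer combination of
positive roots e_i - e_j (i < j).\<close>
definition wt_le :: "nat \<Rightarrow> weight \<Rightarrow> weight \<Rightarrow> bool" where
  "wt_le n mu nu \<longleftrightarrow> (\<exists>c :: nat \<Rightarrow> nat \<Rightarrow> nat.
      wt_eq n (wt_diff nu mu)
        (\<lambda>t. \<Sum>i\<in>{1..n}. \<Sum>j\<in>{i<..n}.
               int (c i j) * ((if t = i then 1 else 0) - (if t = j then 1 else 0))))"

definition wt_lt :: "nat \<Rightarrow> weight \<Rightarrow> weight \<Rightarrow> bool" where
  "wt_lt n mu nu \<longleftrightarrow> wt_le n mu nu \<and> \<not> wt_eq n mu nu"

text \<open>Membership in the Weyl group orbit W gamma, W = S_n permuting coordinates.\<close>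
definition in_W_orbit :: "nat \<Rightarrow> weight \<Rightarrow> weight \<Rightarrow> bool" where
  "in_W_orbit n x gamma \<longleftrightarrow> (\<exists>p. p permutes {1..n} \<and> wt_eq n x (gamma \<circ> p))"

definition dominant :: "nat \<Rightarrow> weight \<Rightarrow> bool" where
  "dominant n x \<longleftrightarrow> (\<forall>i. 1 \<le> i \<and> i < n \<longrightarrow> x (Suc i) \<le> x i)"

definition minuscule_dominant :: "nat \<Rightarrow> weight \<Rightarrow> bool" where
  "minuscule_dominant n x \<longleftrightarrow> (\<exists>a\<in>{1..n-1}. wt_eq n x (omega n a))"

text \<open>The set P_lambda: sequences mu_0,...,mu_k (a list of length k+1) of dominant weights,
mu_0 = mu_k = 0, mu_i - mu_(i-1) in W lambda_i (lambda given as a list of length k).\<close>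
definition in_P :: "nat \<Rightarrow> weight list \<Rightarrow> weight list \<Rightarrow> bool" where
  "in_P n lams mus \<longleftrightarrow>
     length mus = Suc (length lams) \<and>
     (\<forall>i\<le>length lams. dominant n (mus ! i)) \<and>
     wt_eq n (mus ! 0) wt_zero \<and> wt_eq n (mus ! length lams) wt_zero \<and>
     (\<forall>i<length lams. in_W_orbit n (wt_diff (mus ! Suc i) (mus ! i)) (lams ! i))"

section \<open>Webs as combinatorial maps\<close>

text \<open>A web in a disk is encoded as a combinatorial map (darts, edge involution al,
counterclockwise vertex rotation sg) of the planar graph formed by the web together with
the boundary circle.  The circle has vertices: the marked point m and the boundary
vertices p_1..p_k in clockwise order; cd = [c_0, ..., c_k] are the circle darts pointing
clockwise (c_i goes from p_i to p_(i+1), with p_0 = p_(k+1) = m).  wd is the set of darts of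
web edges; lab d is the label of the web edge oriented away from the vertex of dart d.
Faces are the orbits of phi = sg o al; the orbit of d is the face to the right of d.\<close>

record web =
  wd  :: "nat set"
  cd  :: "nat list"
  al  :: "nat \<Rightarrow> nat"
  sg  :: "nat \<Rightarrow> nat"
  lab :: "nat \<Rightarrow> nat"

definition orb :: "('a \<Rightarrow> 'a) \<Rightarrow> 'a \<Rightarrow> 'a set" where
  "orb f x = {(f ^^ k) x | k. True}"

definition orbits :: "('a \<Rightarrow> 'a) \<Rightarrow> 'a set \<Rightarrow> 'a set set" where
  "orbits f H = {orb f x | x. x \<in> H}"

definition darts :: "web \<Rightarrow> nat set" where
  "darts W = wd W \<union> set (cd W) \<union> al W ` set (cd W)"

definition phi :: "web \<Rightarrow> nat \<Rightarrow> nat" where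
  "phi W = sg W \<circ> al W"

definition face :: "web \<Rightarrow> nat \<Rightarrow> nat set" where
  "face W d = orb (phi W) d"

text \<open>number of boundary points\<close>
definition nbd :: "web \<Rightarrow> nat" where
  "nbd W = length (cd W) - 1"

text \<open>the web dart at the (i+1)-st boundary vertex (0-based i < k), pointing into the disk\<close>
definition bdart :: "web \<Rightarrow> nat \<Rightarrow> nat" where
  "bdart W i = sg W (al W (cd W ! i))"

definition is_web :: "nat \<Rightarrow> web \<Rightarrow> bool" where
  "is_web n W \<longleftrightarrow>
     (let H = darts W; k = nbd W; c = cd W; a = al W; s = sg W in
       cd W \<noteq> [] \<and> finite (wd W) \<and> distinct c \<and>
       wd W \<inter> set c = {} \<and> wd W \<inter> a ` set c = {} \<and> set c \<inter> a ` set c = {} \<and>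
       (\<forall>d\<in>H. a (a d) = d \<and> a d \<noteq> d) \<and> (\<forall>d\<in>wd W. a d \<in> wd W) \<and>
       s permutes H \<and>
       \<comment> \<open>the marked point: degree 2 on the circle\<close>
       s (c ! 0) = a (c ! k) \<and> s (a (c ! k)) = c ! 0 \<and>
       \<comment> \<open>boundary vertices: univalent in the web, counterclockwise order
           (incoming arc, web edge, outgoing arc)\<close>
       (\<forall>i<k. bdart W i \<in> wd W \<and> s (bdart W i) = c ! Suc i \<and> s (c ! Suc i) = a (c ! i)) \<and>
       \<comment> \<open>labels\<close>
       (\<forall>d\<in>wd W. lab W d \<in> {1..n-1} \<and> lab W (a d) = n - lab W d) \<and>
       \<comment> \<open>internal vertices: trivalent, flow conservation mod n\<close>
       (\<forall>d\<in>wd W. d \<notin> bdart W ` {..<k} \<longrightarrow>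
           card (orb s d) = 3 \<and> orb s d \<subseteq> wd W \<and> (\<Sum>x\<in>orb s d. lab W x) mod n = 0) \<and>
       \<comment> \<open>connected and planar (Euler characteristic 2)\<close>
       (\<forall>x\<in>H. \<forall>y\<in>H. (x, y) \<in> ({(z, a z) | z. z \<in> H} \<union> {(z, s z) | z. z \<in> H})\<^sup>*) \<and>
       2 * card (orbits s H) + 2 * card (orbits (phi W) H) = card H + 4)"

text \<open>Boundary of the web: the label omega_a of the i-th boundary edge oriented outward.\<close>
definition web_boundary :: "nat \<Rightarrow> web \<Rightarrow> weight list" where
  "web_boundary n W = map (\<lambda>i. omega n (lab W (al W (bdart W i)))) [0..<nbd W]"

section \<open>The dual diskoid and geodesics\<close>

text \<open>Vertices of D(w): the faces inside the disk.\<close>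
definition dvert :: "web \<Rightarrow> nat set set" where
  "dvert W = {face W d | d. d \<in> wd W \<or> d \<in> set (cd W)}"

text \<open>External vertices v_0 .. v_k and the marked vertex.\<close>
definition ext :: "web \<Rightarrow> nat \<Rightarrow> nat set" where
  "ext W i = face W (cd W ! i)"

definition mark :: "web \<Rightarrow> nat set" where
  "mark W = ext W 0"

text \<open>Each web dart d gives a step in D(w) from face d to face (al d), crossing the web edge
of d; its length is omega of lab (al d) (see NOTES.md for the orientation convention).
A path in D(w) is a list of web darts.\<close>
fun walk :: "web \<Rightarrow> nat set \<Rightarrow> nat list \<Rightarrow> nat set \<Rightarrow> bool" where
  "walk W f [] g \<longleftrightarrow> g = f \<and> f \<in> dvert W"
| "walk W f (d # ds) g \<longleftrightarrow> d \<in> wd W \<and> face W d = f \<and> walk W (face W (al W d)) ds g"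

fun len :: "nat \<Rightarrow> web \<Rightarrow> nat list \<Rightarrow> weight" where
  "len n W [] = wt_zero"
| "len n W (d # ds) = (\<lambda>i. omega n (lab W (al W d)) i + len n W ds i)"

definition geodesic :: "nat \<Rightarrow> web \<Rightarrow> nat set \<Rightarrow> nat list \<Rightarrow> nat set \<Rightarrow> bool" where
  "geodesic n W f ds g \<longleftrightarrow> walk W f ds g \<and>
     \<not> (\<exists>ds'. walk W f ds' g \<and> wt_lt n (len n W ds') (len n W ds))"

definition coherent_geodesics :: "nat \<Rightarrow> web \<Rightarrow> nat set \<Rightarrow> nat set \<Rightarrow> bool" where
  "coherent_geodesics n W f g \<longleftrightarrow>
     (\<forall>ds ds'. geodesic n W f ds g \<and> geodesic n W f ds' g \<longrightarrow>
        wt_eq n (len n W ds) (len n W ds'))"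

definition dist :: "nat \<Rightarrow> web \<Rightarrow> nat set \<Rightarrow> nat set \<Rightarrow> weight" where
  "dist n W f g = len n W (SOME ds. geodesic n W f ds g)"

definition on_walk :: "web \<Rightarrow> nat set \<Rightarrow> nat list \<Rightarrow> nat set \<Rightarrow> bool" where
  "on_walk W h ds g \<longleftrightarrow> h \<in> face W ` set ds \<or> h = g"

definition coherent :: "nat \<Rightarrow> web \<Rightarrow> bool" where
  "coherent n W \<longleftrightarrow>
     (\<forall>v\<in>dvert W. coherent_geodesics n W (mark W) v) \<and>
     (\<forall>v\<in>dvert W. v \<notin> ext W ` {..nbd W} \<longrightarrow>
        (\<exists>i\<le>nbd W. \<exists>ds. geodesic n W (mark W) ds (ext W i) \<and> on_walk W v ds (ext W i))) \<and>
     (\<forall>d\<in>wd W. in_W_orbit n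
        (wt_diff (dist n W (mark W) (face W (al W d))) (dist n W (mark W) (face W d)))
        (omega n (lab W (al W d))))"

definition associated_path :: "nat \<Rightarrow> web \<Rightarrow> weight list" where
  "associated_path n W = map (\<lambda>i. dist n W (mark W) (ext W i)) [0..<Suc (nbd W)]"

definition wt_list_eq :: "nat \<Rightarrow> weight list \<Rightarrow> weight list \<Rightarrow> bool" where
  "wt_list_eq n xs ys \<longleftrightarrow> length xs = length ys \<and> (\<forall>i<length xs. wt_eq n (xs ! i) (ys ! i))"

end

theory Submission
  imports Defs
begin

text \<open>Give the faces of a web weights \<open>\<delta>\<close>, starting with 0 at the marked face, such that \<open>\<delta>\<close> changes by an
element of some orbit \<open>W \<omega>\<^sub>a\<close> across every edge.  As \<open>w \<omega>\<^sub>a \<le> \<omega>\<^sub>a\<close>, the length of every path from the marked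
face to \<open>v\<close> is at least \<open>\<delta> v\<close>.  If moreover every face can be reached by steps that add exactly a
fundamental weight, then \<open>\<delta>\<close> is the distance from the marked face; and if every internal face can be
left by such steps towards an external one, the web is coherent.  The labels are determined by \<open>\<delta>\<close>, and
flow conservation holds because the differences of \<open>\<delta>\<close> telescope around a vertex.

A web with prescribed values of \<open>\<delta>\<close> on the external faces is built from the inside outwards, by
attaching caps, trivalent vertices and H's at the boundary.  Read backwards, these moves turn the given
path of dominant weights into the trivial one: a step by \<open>w \<omega>\<^sub>a\<close> preceded only by fundamental steps is
pushed towards the marked point, losing one run of consecutive indices at each move.\<close>

section \<open>Orbits of permutations and planar maps\<close>

lemma orb_self [simp]: "x \<in> orb f x"
  unfolding orb_def by (auto intro: exI[of _ 0])

lemma orb_step: "y \<in> orb f x \<Longrightarrow> f y \<in> orb f x"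
  unfolding orb_def by (auto intro: exI[of _ "Suc _"])

lemma orb_least:
  assumes "x \<in> A" "\<And>y. y \<in> A \<Longrightarrow> f y \<in> A"
  shows "orb f x \<subseteq> A"
proof -
  have "(f ^^ k) x \<in> A" for k by (induction k) (auto simp: assms)
  then show ?thesis unfolding orb_def by auto
qed

lemma orb_subset: "y \<in> orb f x \<Longrightarrow> orb f y \<subseteq> orb f x"
  by (rule orb_least) (auto intro: orb_step)

lemma orb_eq:
  assumes f: "f permutes H" and fin: "finite H" and y: "y \<in> orb f x"
  shows "orb f y = orb f x"
proof
  show "orb f y \<subseteq> orb f x" using y by (rule orb_subset)
  have "orb f y \<subseteq> insert y H"
    by (rule orb_least) (use permutes_not_in[OF f] permutes_in_image[OF f] in auto)
  then have "finite (orb f y)" using fin by (meson finite_insert finite_subset)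
  moreover have "f ` orb f y \<subseteq> orb f y" by (auto intro: orb_step)
  ultimately have surj: "f ` orb f y = orb f y"
    using endo_inj_surj permutes_inj_on[OF f] by metis
  have pre: "w \<in> orb f y" if "f w \<in> orb f y" for w
  proof -
    obtain v where "v \<in> orb f y" "f w = f v" using \<open>f w \<in> orb f y\<close> surj by (metis imageE)
    then show ?thesis using injD[OF permutes_inj[OF f]] by metis
  qed
  from y obtain k where k: "y = (f ^^ k) x" by (auto simp: orb_def)
  have "(f ^^ k) w \<in> orb f y \<Longrightarrow> w \<in> orb f y" for w
    by (induction k) (auto dest: pre)
  then have "x \<in> orb f y" using k orb_self by metis
  then show "orb f x \<subseteq> orb f y" by (rule orb_subset)
qed

lemma orb_eq_iff:
  assumes "f permutes H" "finite H"
  shows "orb f x = orb f y \<longleftrightarrow> y \<in> orb f x"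
  using orb_eq[OF assms] orb_self by metis

lemma orb_subset_carrier:
  assumes "f permutes H" "x \<in> H" shows "orb f x \<subseteq> H"
  by (rule orb_least) (auto simp: assms permutes_in_image)

lemma orbits_image: "orbits f H = orb f ` H"
  unfolding orbits_def by auto

definition ins :: "('a \<Rightarrow> 'a) \<Rightarrow> 'a \<Rightarrow> 'a \<Rightarrow> 'a \<Rightarrow> 'a" where
  "ins f e x = f(e := x, x := f e)"

lemma ins_permutes:
  assumes "f permutes H" "e \<in> H" "x \<notin> H"
  shows "ins f e x permutes insert x H"
proof -
  have "ins f e x = f \<circ> transpose e x"
    using assms permutes_not_in[OF assms(1,3)]
    by (auto simp: ins_def fun_eq_iff transpose_def)
  moreover have "f \<circ> transpose e x permutes insert x H"
    using assms by (intro permutes_compose permutes_swap_id) (auto intro: permutes_subset)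
  ultimately show ?thesis by simp
qed

lemma orb_ins:
  assumes "f permutes H" "e \<in> H" "x \<notin> H" "d \<in> H"
  shows "orb (ins f e x) d = (if e \<in> orb f d then insert x (orb f d) else orb f d)"
proof -
  let ?g = "ins f e x"
  have sub: "orb f d \<subseteq> orb ?g d"
  proof -
    have "orb f d \<subseteq> orb ?g d \<inter> H"
    proof (rule orb_least)
      fix y assume y: "y \<in> orb ?g d \<inter> H"
      have "f y \<in> orb ?g d"
      proof (cases "y = e")
        case True
        then have "?g (?g y) = f y" using assms by (auto simp: ins_def)
        then show ?thesis using y by (metis IntD1 orb_step)
      next
        case False
        then have "?g y = f y" using y assms by (auto simp: ins_def)
        then show ?thesis using y by (metis IntD1 orb_step)
      qed
      then show "f y \<in> orb ?g d \<inter> H" using y assms permutes_in_image by fastforce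
    qed (use assms in auto)
    then show ?thesis by simp
  qed
  have dH: "orb f d \<subseteq> H" by (rule orb_subset_carrier) (use assms in auto)
  show ?thesis
  proof (cases "e \<in> orb f d")
    case True
    have "orb ?g d \<subseteq> insert x (orb f d)"
      by (rule orb_least) (use True in \<open>auto simp: ins_def orb_step\<close>)
    moreover have "x \<in> orb ?g d"
      using orb_step[of e ?g d] True sub by (auto simp: ins_def split: if_splits)
    ultimately show ?thesis using sub True by auto
  next
    case False
    have "orb ?g d \<subseteq> orb f d"
      by (rule orb_least) (use False dH assms(3) in \<open>auto simp: ins_def orb_step\<close>)
    then show ?thesis using sub False by auto
  qed
qed

lemma orb_ins_mono:
  assumes "f permutes H" "e \<in> H" "x \<notin> H" "d \<in> H" "y \<in> orb f d"
  shows "y \<in> orb (ins f e x) d"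
  using orb_ins[OF assms(1-4)] assms(5) by auto

lemma card_orbits_ins:
  assumes f: "f permutes H" and fin: "finite H" and e: "e \<in> H" and x: "x \<notin> H"
  shows "card (orbits (ins f e x) (insert x H)) = card (orbits f H)"
proof -
  let ?g = "ins f e x"
  have g: "?g permutes insert x H" by (rule ins_permutes[OF f e x])
  have "x \<in> orb ?g e" using orb_step[OF orb_self, of ?g e] e x by (auto simp: ins_def split: if_splits)
  then have "orb ?g x = orb ?g e" using orb_eq[OF g] fin by auto
  then have "orbits ?g (insert x H) = orb ?g ` H" using e by (auto simp: orbits_image)
  also have "\<dots> = (\<lambda>A. if e \<in> A then insert x A else A) ` orbits f H"
    unfolding orbits_image image_image
    by (rule image_cong) (use orb_ins[OF f e x] in auto)
  also have "card \<dots> = card (orbits f H)"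
  proof (rule card_image, rule inj_onI)
    fix A B assume "A \<in> orbits f H" "B \<in> orbits f H"
      and eq: "(if e \<in> A then insert x A else A) = (if e \<in> B then insert x B else B)"
    then have "A \<subseteq> H" "B \<subseteq> H"
      using orb_subset_carrier[OF f] by (auto simp: orbits_image)
    then show "A = B" using eq x e by (auto split: if_splits)
  qed
  finally show ?thesis .
qed

lemma split_permutes:
  assumes "f permutes H" "a \<in> H" "b \<in> H"
  shows "f(a := f b, b := f a) permutes H"
proof -
  have "f(a := f b, b := f a) = f \<circ> transpose a b"
    by (auto simp: fun_eq_iff transpose_def)
  then show ?thesis using assms by (simp add: permutes_compose permutes_swap_id)
qed

lemma card_orbits_split:
  assumes f: "f permutes H" and fin: "finite H" and a: "a \<in> H" and b: "b \<in> orb f a" and "a \<noteq> b"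
  shows "card (orbits (f(a := f b, b := f a)) H) = Suc (card (orbits f H))"
proof -
  let ?g = "f(a := f b, b := f a)"
  have bH: "b \<in> H" using orb_subset_carrier[OF f a] b by auto
  have g: "?g permutes H" by (rule split_permutes[OF f a bH])
  obtain k where k: "b = (f ^^ k) a" and kmin: "\<And>i. b = (f ^^ i) a \<Longrightarrow> k \<le> i"
  proof -
    have "\<exists>k. b = (f ^^ k) a" using b by (auto simp: orb_def)
    then show ?thesis using that LeastI_ex[of "\<lambda>k. b = (f ^^ k) a"] Least_le[of "\<lambda>k. b = (f ^^ k) a"]
      by blast
  qed
  have kpos: "k > 0" using k \<open>a \<noteq> b\<close> by (cases k) auto
  define B where "B = (\<lambda>i. (f ^^ i) a) ` {1..k}"
  have aB: "a \<notin> B"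
  proof
    assume "a \<in> B"
    then obtain i where i: "1 \<le> i" "i \<le> k" "(f ^^ i) a = a" by (auto simp: B_def)
    have "b = (f ^^ (k - i)) ((f ^^ i) a)"
      using k i(2) by (metis comp_apply funpow_add le_add_diff_inverse2)
    then have "k \<le> k - i" using kmin i(3) by auto
    then show False using i kpos by auto
  qed
  have "orb ?g b \<subseteq> B"
  proof (rule orb_least)
    show "b \<in> B" using k kpos by (auto simp: B_def)
    fix y assume y: "y \<in> B"
    then obtain i where i: "1 \<le> i" "i \<le> k" "y = (f ^^ i) a" by (auto simp: B_def)
    show "?g y \<in> B"
    proof (cases "i = k")
      case True
      then have "?g y = (f ^^ 1) a" using i k by simp
      then show ?thesis using kpos unfolding B_def by force
    next
      case False
      then have "y \<noteq> b" using i kmin by fastforce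
      moreover have "y \<noteq> a" using y aB by auto
      ultimately have "?g y = (f ^^ Suc i) a" using i by simp
      moreover have "Suc i \<in> {1..k}" using i False by simp
      ultimately show ?thesis unfolding B_def by blast
    qed
  qed
  then have a_notin: "a \<notin> orb ?g b" using aB by auto
  have un: "orb f a = orb ?g a \<union> orb ?g b"
  proof
    have st: "f y \<in> orb ?g a \<union> orb ?g b" if "y \<in> orb ?g a \<union> orb ?g b" for y
    proof -
      consider "y = a" | "y = b" | "y \<noteq> a" "y \<noteq> b" by auto
      then show ?thesis
      proof cases
        case 1
        then have "f y = ?g b" by simp
        then show ?thesis by (metis UnI2 orb_self orb_step)
      next
        case 2
        then have "f y = ?g a" using \<open>a \<noteq> b\<close> by simp
        then show ?thesis by (metis UnI1 orb_self orb_step)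
      next
        case 3
        then have "f y = ?g y" by simp
        then show ?thesis using that by (metis Un_iff orb_step)
      qed
    qed
    show "orb f a \<subseteq> orb ?g a \<union> orb ?g b"
      by (rule orb_least) (use st in auto)
    have st': "?g y \<in> orb f a" if "y \<in> orb f a" for y
      using that b by (auto intro: orb_step)
    have "orb ?g a \<subseteq> orb f a" by (rule orb_least) (use st' in auto)
    moreover have "orb ?g b \<subseteq> orb f a" by (rule orb_least) (use st' b in auto)
    ultimately show "orb ?g a \<union> orb ?g b \<subseteq> orb f a" by auto
  qed
  have other: "orb ?g d = orb f d" if "d \<in> H" "d \<notin> orb f a" for d
  proof -
    have na: "a \<notin> orb f d" "b \<notin> orb f d"
      using that orb_eq[OF f fin] b orb_self by metis+
    have 1: "orb ?g d \<subseteq> orb f d"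
      by (rule orb_least) (use na in \<open>auto simp: orb_step\<close>)
    have "orb f d \<subseteq> orb ?g d \<inter> orb f d"
    proof (rule orb_least)
      fix y assume y: "y \<in> orb ?g d \<inter> orb f d"
      then have "?g y = f y" using na by auto
      then show "f y \<in> orb ?g d \<inter> orb f d" using y orb_step[of y ?g d] orb_step[of y f d] by auto
    qed auto
    then show ?thesis using 1 by auto
  qed
  have "orbits ?g H = insert (orb ?g a) (insert (orb ?g b) (orbits f H - {orb f a}))"
  proof -
    have "orbits f H - {orb f a} = orb f ` (H - orb f a)"
      using orb_eq_iff[OF f fin] by (auto simp: orbits_image)
    also have "\<dots> = orb ?g ` (H - orb f a)" using other by (intro image_cong) auto
    finally have 1: "orbits f H - {orb f a} = orb ?g ` (H - orb f a)" .
    have "orb ?g d = orb ?g a \<or> orb ?g d = orb ?g b" if "d \<in> orb f a" for d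
      using that un orb_eq[OF g fin] by auto
    then have 2: "orb ?g ` orb f a = {orb ?g a, orb ?g b}" using b by auto
    have "orb ?g ` H = orb ?g ` orb f a \<union> orb ?g ` (H - orb f a)"
      using orb_subset_carrier[OF f a] by auto
    then show ?thesis unfolding orbits_image[of ?g] using 1 2 by auto
  qed
  moreover have "orb ?g a \<noteq> orb ?g b" using a_notin by (metis orb_self)
  moreover have other: "orb ?g c \<notin> orbits f H - {orb f a}" if c: "c \<in> orb f a" for c
  proof
    assume "orb ?g c \<in> orbits f H - {orb f a}"
    then obtain d where d: "orb f d = orb ?g c" "orb ?g c \<noteq> orb f a" by (auto simp: orbits_image)
    then have "c \<in> orb f d" by simp
    then show False using c d orb_eq[OF f fin] by metis
  qed
  moreover note other[OF orb_self] other[OF b]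
  moreover have "finite (orbits f H)" "orb f a \<in> orbits f H" using fin a by (auto simp: orbits_image)
  moreover from this have "card (orbits f H) = Suc (card (orbits f H - {orb f a}))"
    by (rule card.remove)
  ultimately show ?thesis by simp
qed

definition links :: "'a set \<Rightarrow> ('a \<Rightarrow> 'a) \<Rightarrow> ('a \<Rightarrow> 'a) \<Rightarrow> ('a \<times> 'a) set" where
  "links H a s = {(z, a z) | z. z \<in> H} \<union> {(z, s z) | z. z \<in> H}"

lemma links_al: "z \<in> H \<Longrightarrow> (z, a z) \<in> links H a s"
  and links_sg: "z \<in> H \<Longrightarrow> (z, s z) \<in> links H a s"
  by (auto simp: links_def)

lemma links_subsetI:
  "(\<And>d. d \<in> H \<Longrightarrow> (d, a d) \<in> R) \<Longrightarrow> (\<And>d. d \<in> H \<Longrightarrow> (d, s d) \<in> R) \<Longrightarrow> links H a s \<subseteq> R"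
  by (auto simp: links_def)

definition planar_map :: "'a set \<Rightarrow> ('a \<Rightarrow> 'a) \<Rightarrow> ('a \<Rightarrow> 'a) \<Rightarrow> bool" where
  "planar_map H a s \<longleftrightarrow> finite H \<and> a permutes H \<and> (\<forall>d. a (a d) = d) \<and> (\<forall>d\<in>H. a d \<noteq> d) \<and>
     s permutes H \<and> (\<forall>x\<in>H. \<forall>y\<in>H. (x, y) \<in> (links H a s)\<^sup>*) \<and>
     2 * card (orbits s H) + 2 * card (orbits (s \<circ> a) H) = card H + 4"

lemma involution_permutes:
  assumes "\<And>d. a (a d) = d" "\<And>d. d \<notin> H \<Longrightarrow> a d = d"
  shows "a permutes H"
  unfolding permutes_def using assms by metis

lemma connected_extend:
  assumes old: "\<forall>x\<in>H. \<forall>y\<in>H. (x, y) \<in> R\<^sup>*" and "R \<subseteq> R'\<^sup>*"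
    and new: "\<And>x. x \<in> H' \<Longrightarrow> x \<in> H \<or> (\<exists>y\<in>H. (x, y) \<in> R'\<^sup>*) \<and> (\<exists>y\<in>H. (y, x) \<in> R'\<^sup>*)"
  shows "\<forall>x\<in>H'. \<forall>y\<in>H'. (x, y) \<in> R'\<^sup>*"
proof (intro ballI)
  fix x y assume "x \<in> H'" "y \<in> H'"
  then obtain x' y' where "x' \<in> H" "y' \<in> H" "(x, x') \<in> R'\<^sup>*" "(y', y) \<in> R'\<^sup>*"
    using new[of x] new[of y] by blast
  moreover have "R\<^sup>* \<subseteq> R'\<^sup>*" using assms(2) by (metis rtrancl_idemp rtrancl_mono)
  ultimately show "(x, y) \<in> R'\<^sup>*" using old by (meson rtrancl_trans subsetD)
qed

definition sub_al :: "('a \<Rightarrow> 'a) \<Rightarrow> 'a \<Rightarrow> 'a \<Rightarrow> 'a \<Rightarrow> 'a \<Rightarrow> 'a" where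
  "sub_al a e x y = a(e := x, x := e, y := a e, a e := y)"

lemma planar_map_subdivide:
  assumes pm: "planar_map H a s" and e: "e \<in> H" and xy: "x \<notin> H" "y \<notin> H" "x \<noteq> y"
  shows "planar_map (insert x (insert y H)) (sub_al a e x y) (s(x := y, y := x))"
    and "sub_al a e x y permutes insert x (insert y H)"
    and "s(x := y, y := x) \<circ> sub_al a e x y = ins (ins (s \<circ> a) e y) (a e) x"
proof -
  let ?H = "insert x (insert y H)" and ?a = "sub_al a e x y" and ?s = "s(x := y, y := x)"
  have fin: "finite H" and aH: "a permutes H" and aa: "\<And>d. a (a d) = d" and an: "\<And>d. d \<in> H \<Longrightarrow> a d \<noteq> d"
    and sH: "s permutes H" and conn: "\<forall>x\<in>H. \<forall>y\<in>H. (x, y) \<in> (links H a s)\<^sup>*"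
    and eul: "2 * card (orbits s H) + 2 * card (orbits (s \<circ> a) H) = card H + 4"
    using pm by (auto simp: planar_map_def)
  have ae: "a e \<in> H" "a e \<noteq> e" using aH e an by (auto simp: permutes_in_image)
  have ax: "a x = x" "a y = y" "s x = x" "s y = y" using aH sH xy by (auto simp: permutes_not_in)
  have ne: "x \<noteq> e" "y \<noteq> e" "x \<noteq> a e" "y \<noteq> a e" using xy e ae by auto
  have ainv: "?a (?a d) = d" for d
    using ae ne xy ax aa by (auto simp: sub_al_def) metis+
  show aP: "?a permutes ?H"
    by (rule involution_permutes[OF ainv])
       (use aH e ae in \<open>auto simp: sub_al_def permutes_not_in\<close>)
  have sP: "?s permutes ?H"
  proof -
    have "?s = s \<circ> transpose x y" using ax by (auto simp: fun_eq_iff transpose_def)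
    then show ?thesis using permutes_compose[OF permutes_swap_id[of x ?H y] permutes_subset[OF sH, of ?H]] by auto
  qed
  show phi: "?s \<circ> ?a = ins (ins (s \<circ> a) e y) (a e) x"
    using ax ne ae aa xy by (auto simp: fun_eq_iff ins_def sub_al_def)
  have pP: "s \<circ> a permutes H" by (rule permutes_compose[OF aH sH])
  have faces: "card (orbits (?s \<circ> ?a) ?H) = card (orbits (s \<circ> a) H)"
    unfolding phi
    using card_orbits_ins[OF ins_permutes[OF pP e xy(2)], of "a e" x] card_orbits_ins[OF pP fin e xy(2)]
    fin e ae xy by auto
  have verts: "card (orbits ?s ?H) = Suc (card (orbits s H))"
  proof -
    have old: "orb ?s d = orb s d" if "d \<in> H" for d
    proof
      show "orb ?s d \<subseteq> orb s d"
        by (rule orb_least) (use that orb_subset_carrier[OF sH that] xy in \<open>auto simp: orb_step\<close>)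
      have "orb s d \<subseteq> orb ?s d \<inter> H"
      proof (rule orb_least)
        fix z assume z: "z \<in> orb ?s d \<inter> H"
        then have "?s z = s z" using xy by auto
        then show "s z \<in> orb ?s d \<inter> H" using z orb_step[of z ?s d] sH by (auto simp: permutes_in_image)
      qed (use that in auto)
      then show "orb s d \<subseteq> orb ?s d" by auto
    qed
    have nx: "orb ?s x = {x, y}" 
    proof
      show "orb ?s x \<subseteq> {x, y}" by (rule orb_least) auto
      show "{x, y} \<subseteq> orb ?s x" using orb_step[OF orb_self, of ?s x] xy(3) by (auto split: if_splits)
    qed
    have "orb ?s y = {x, y}"
    proof
      show "orb ?s y \<subseteq> {x, y}" by (rule orb_least) auto
      show "{x, y} \<subseteq> orb ?s y" using orb_step[OF orb_self, of ?s y] xy(3) by (auto split: if_splits)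
    qed
    then have "orbits ?s ?H = insert {x, y} (orbits s H)" using old nx by (auto simp: orbits_image)
    moreover have "{x, y} \<notin> orbits s H" using orb_subset_carrier[OF sH] xy by (auto simp: orbits_image)
    ultimately show ?thesis using fin by (simp add: orbits_image)
  qed
  have e1: "(e, x) \<in> links ?H ?a ?s" "(x, e) \<in> links ?H ?a ?s" "(x, y) \<in> links ?H ?a ?s" "(y, x) \<in> links ?H ?a ?s"
      "(y, a e) \<in> links ?H ?a ?s" "(a e, y) \<in> links ?H ?a ?s"
    using links_al[of e ?H ?a ?s] links_al[of x ?H ?a ?s] links_sg[of x ?H ?s ?a] links_sg[of y ?H ?s ?a]
      links_al[of y ?H ?a ?s] links_al[of "a e" ?H ?a ?s] e ae ne xy
    by (simp_all add: sub_al_def)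
  have sub: "links H a s \<subseteq> (links ?H ?a ?s)\<^sup>*"
  proof -
    have "(d, a d) \<in> (links ?H ?a ?s)\<^sup>*" if d: "d \<in> H" for d
    proof -
      consider "d = e" | "d = a e" | "d \<noteq> e" "d \<noteq> a e" by auto
      then show ?thesis
      proof cases
        case 1 then show ?thesis using e1 by (meson rtrancl.simps)
      next
        case 2
        have "(a e, e) \<in> (links ?H ?a ?s)\<^sup>*" using e1 by (meson rtrancl.simps)
        then show ?thesis using 2 aa by simp
      next
        case 3
        then have "?a d = a d" using d xy aa by (auto simp: sub_al_def)
        then show ?thesis using d links_al[of d ?H ?a ?s] by auto
      qed
    qed
    moreover have "(d, s d) \<in> (links ?H ?a ?s)\<^sup>*" if d: "d \<in> H" for d
    proof -
      have "?s d = s d" using d xy by auto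
      then show ?thesis using d links_sg[of d ?H ?s ?a] by auto
    qed
    ultimately show ?thesis by (rule links_subsetI)
  qed
  have conn': "\<forall>x\<in>?H. \<forall>y\<in>?H. (x, y) \<in> (links ?H ?a ?s)\<^sup>*"
    by (rule connected_extend[OF conn sub]) (use e1 e ae in \<open>blast\<close>)
  have fpf: "\<forall>d\<in>?H. ?a d \<noteq> d"
    using an ne xy aa ae e by (auto simp: sub_al_def)
  show "planar_map ?H ?a ?s"
    unfolding planar_map_def
    using fin aP ainv fpf sP conn' eul faces verts xy by auto
qed

lemma planar_map_add_edge:
  assumes pm: "planar_map H a s" and c: "c \<in> H" "c' \<in> H" "c \<noteq> c'"
    and same: "a c' \<in> orb (s \<circ> a) (a c)" and z: "z \<notin> H" "z' \<notin> H" "z \<noteq> z'"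
  shows "planar_map (insert z (insert z' H)) (a(z := z', z' := z)) (s(c := z, z := s c, c' := z', z' := s c'))"
proof -
  let ?H = "insert z (insert z' H)" and ?a = "a(z := z', z' := z)" 
    and ?s = "s(c := z, z := s c, c' := z', z' := s c')"
  have fin: "finite H" and aH: "a permutes H" and aa: "\<And>d. a (a d) = d" and an: "\<And>d. d \<in> H \<Longrightarrow> a d \<noteq> d"
    and sH: "s permutes H" and conn: "\<forall>x\<in>H. \<forall>y\<in>H. (x, y) \<in> (links H a s)\<^sup>*"
    and eul: "2 * card (orbits s H) + 2 * card (orbits (s \<circ> a) H) = card H + 4"
    using pm by (auto simp: planar_map_def)
  have az: "a z = z" "a z' = z'" "s z = z" "s z' = z'" using aH sH z by (auto simp: permutes_not_in)
  have ac: "a c \<in> H" "a c' \<in> H" "a c \<noteq> a c'" using aH c aa by (auto simp: permutes_in_image) metis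
  have ne: "z \<noteq> c" "z \<noteq> c'" "z' \<noteq> c" "z' \<noteq> c'" "z \<noteq> a c" "z \<noteq> a c'" "z' \<noteq> a c" "z' \<noteq> a c'"
    using z c ac by auto
  have ainv: "?a (?a d) = d" for d
    using aa az z by auto
  have aP: "?a permutes ?H"
    by (rule involution_permutes[OF ainv]) (use aH in \<open>auto simp: permutes_not_in\<close>)
  have s_eq: "?s = ins (ins s c z) c' z'"
    using ne c by (auto simp: ins_def fun_eq_iff)
  have s1: "ins s c z permutes insert z H" by (rule ins_permutes[OF sH c(1) z(1)])
  have sP: "?s permutes ?H"
    unfolding s_eq using ins_permutes[OF s1, of c' z'] c z by (auto simp: insert_commute)
  have verts: "card (orbits ?s ?H) = card (orbits s H)"
    unfolding s_eq using card_orbits_ins[OF s1, of c' z'] card_orbits_ins[OF sH fin c(1) z(1)] fin c z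
    by (auto simp: insert_commute)
  let ?f = "s \<circ> a"
  let ?g = "?f(a c := ?f (a c'), a c' := ?f (a c))"
  have phi: "?s \<circ> ?a = ins (ins ?g (a c) z) (a c') z'"
  proof
    fix d
    have "a d = c \<longleftrightarrow> d = a c" "a d = c' \<longleftrightarrow> d = a c'" using aa by metis+
    moreover have "a d = z \<longleftrightarrow> d = z" "a d = z' \<longleftrightarrow> d = z'" using aa az by metis+
    ultimately show "(?s \<circ> ?a) d = ins (ins ?g (a c) z) (a c') z' d"
      using ne ac z c aa by (auto simp: ins_def)
  qed
  have pP: "?f permutes H" by (rule permutes_compose[OF aH sH])
  have gP: "?g permutes H" by (rule split_permutes[OF pP ac(1,2)])
  have faces: "card (orbits (?s \<circ> ?a) ?H) = Suc (card (orbits ?f H))"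
    unfolding phi
    using card_orbits_ins[OF ins_permutes[OF gP ac(1) z(1)], of "a c'" z'] card_orbits_ins[OF gP fin ac(1) z(1)]
      card_orbits_split[OF pP fin ac(1) same ac(3)] fin ac z by (auto simp: insert_commute)
  have e1: "(c, z) \<in> links ?H ?a ?s" "(z, s c) \<in> links ?H ?a ?s" "(c', z') \<in> links ?H ?a ?s" "(z', s c') \<in> links ?H ?a ?s"
    using links_sg[of c ?H ?s ?a] links_sg[of z ?H ?s ?a] links_sg[of c' ?H ?s ?a] links_sg[of z' ?H ?s ?a]
      c ne z by simp_all
  have sub: "links H a s \<subseteq> (links ?H ?a ?s)\<^sup>*"
  proof -
    have "(d, a d) \<in> (links ?H ?a ?s)\<^sup>*" if d: "d \<in> H" for d
    proof -
      have "?a d = a d" using d z by auto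
      then show ?thesis using d links_al[of d ?H ?a ?s] by auto
    qed
    moreover have "(d, s d) \<in> (links ?H ?a ?s)\<^sup>*" if d: "d \<in> H" for d
    proof -
      consider "d = c" | "d = c'" | "d \<noteq> c" "d \<noteq> c'" by auto
      then show ?thesis
      proof cases
        case 1 then show ?thesis using e1 by (meson rtrancl.simps)
      next
        case 2 then show ?thesis using e1 by (meson rtrancl.simps)
      next
        case 3
        then have "?s d = s d" using d z by auto
        then show ?thesis using d links_sg[of d ?H ?s ?a] by auto
      qed
    qed
    ultimately show ?thesis by (rule links_subsetI)
  qed
  have "s c \<in> H" "s c' \<in> H" using sH c by (auto simp: permutes_in_image)
  then have conn': "\<forall>x\<in>?H. \<forall>y\<in>?H. (x, y) \<in> (links ?H ?a ?s)\<^sup>*"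
    by (intro connected_extend[OF conn sub]) (use e1 c in \<open>blast\<close>)
  have fpf: "\<forall>d\<in>?H. ?a d \<noteq> d"
    using an z by auto
  show "planar_map ?H ?a ?s"
    unfolding planar_map_def
    using fin aP ainv fpf sP conn' eul faces verts z by auto
qed

section \<open>Attaching pieces at the boundary of a web\<close>

definition arc :: "web \<Rightarrow> nat \<Rightarrow> nat \<Rightarrow> bool" where
  "arc W c c' \<longleftrightarrow> sg W (al W c) \<in> wd W \<and> sg W (sg W (al W c)) = c' \<and> sg W c' = al W c"

text \<open>The unlabelled part of the definition of a web.  Every vertex except the marked point is
trivalent, boundary vertices included, since these carry two circle darts besides the web dart.\<close>

definition disk_map :: "web \<Rightarrow> bool" where
  "disk_map W \<longleftrightarrow> cd W \<noteq> [] \<and> distinct (cd W) \<and>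
     wd W \<inter> set (cd W) = {} \<and> wd W \<inter> al W ` set (cd W) = {} \<and> set (cd W) \<inter> al W ` set (cd W) = {} \<and>
     (\<forall>d\<in>wd W. al W d \<in> wd W) \<and> planar_map (darts W) (al W) (sg W) \<and>
     sg W (hd (cd W)) = al W (last (cd W)) \<and> sg W (al W (last (cd W))) = hd (cd W) \<and>
     successively (arc W) (cd W) \<and>
     (\<forall>d\<in>darts W - {hd (cd W), al W (last (cd W))}. sg W d \<noteq> d \<and> sg W (sg W (sg W d)) = d)"

text \<open>Topologically: put a new vertex on the edge of \<open>c\<close> (darts \<open>x1\<close>, \<open>x2\<close>) and one on the edge of
\<open>e\<close> (darts \<open>y2\<close>, \<open>y1\<close>), and join them by a new edge with darts \<open>z\<close>, \<open>z'\<close>.\<close>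

definition attach_al :: "(nat \<Rightarrow> nat) \<Rightarrow> nat \<Rightarrow> nat \<Rightarrow> nat \<Rightarrow> nat \<Rightarrow> nat \<Rightarrow> nat \<Rightarrow> nat \<Rightarrow> nat \<Rightarrow> nat \<Rightarrow> nat" where
  "attach_al a c e x1 x2 y1 y2 z z' = (sub_al (sub_al a c x1 x2) e y2 y1)(z' := z, z := z')"

definition attach_sg :: "(nat \<Rightarrow> nat) \<Rightarrow> nat \<Rightarrow> nat \<Rightarrow> nat \<Rightarrow> nat \<Rightarrow> nat \<Rightarrow> nat \<Rightarrow> nat \<Rightarrow> nat" where
  "attach_sg s x1 x2 y1 y2 z z' = s(x1 := x2, x2 := z, z := x1, z' := y2, y2 := y1, y1 := z')"

lemma planar_map_attach:
  assumes pm: "planar_map H a s" and c: "c \<in> H" and fresh: "distinct [x1, x2, y1, y2, z, z']"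
    "set [x1, x2, y1, y2, z, z'] \<inter> H = {}"
    and e: "e = x2 \<or> e \<in> H \<and> e \<noteq> c \<and> e \<noteq> a c \<and> a c \<in> orb (s \<circ> a) (a e)"
  shows "planar_map (H \<union> {x1, x2, y1, y2, z, z'}) (attach_al a c e x1 x2 y1 y2 z z') (attach_sg s x1 x2 y1 y2 z z')"
proof -
  let ?a1 = "sub_al a c x1 x2" and ?s1 = "s(x1 := x2, x2 := x1)" and ?H1 = "insert x1 (insert x2 H)"
  let ?a2 = "sub_al ?a1 e y2 y1" and ?s2 = "?s1(y2 := y1, y1 := y2)" and ?H2 = "insert y2 (insert y1 ?H1)"
  have aH: "a permutes H" and sH: "s permutes H" and aa: "\<And>d. a (a d) = d"
    and an: "\<And>d. d \<in> H \<Longrightarrow> a d \<noteq> d"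
    using pm by (auto simp: planar_map_def)
  have ac: "a c \<in> H" "a c \<noteq> c" using c aH an by (auto simp: permutes_in_image)
  have pP: "s \<circ> a permutes H" by (rule permutes_compose[OF aH sH])
  have pm1: "planar_map ?H1 ?a1 ?s1" and phi1: "?s1 \<circ> ?a1 = ins (ins (s \<circ> a) c x2) (a c) x1"
    using planar_map_subdivide[OF pm c, of x1 x2] fresh by auto
  have eH: "e \<in> ?H1" using e by auto
  have pm2: "planar_map ?H2 ?a2 ?s2" and phi2: "?s2 \<circ> ?a2 = ins (ins (?s1 \<circ> ?a1) e y1) (?a1 e) y2"
    using planar_map_subdivide[OF pm1 eH, of y2 y1] fresh by auto
  have same: "?a2 x2 \<in> orb (?s2 \<circ> ?a2) (?a2 y1)"
  proof (cases "e = x2")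
    case True
    then have "?a2 x2 = (?s2 \<circ> ?a2) (?a2 y1)" using fresh c ac by (auto simp: sub_al_def)
    then show ?thesis by (metis orb_self orb_step)
  next
    case False
    then have e: "e \<in> H" "e \<noteq> c" "e \<noteq> a c" "a c \<in> orb (s \<circ> a) (a e)" using e by auto
    then have ae: "a e \<in> H" "a e \<noteq> c" "a e \<noteq> a c" using aH aa by (auto simp: permutes_in_image) metis+
    have v: "?a1 e = a e" "?a2 x2 = a c" "?a2 y1 = a e"
      using fresh c ac e ae by (auto simp: sub_al_def)
    have 1: "ins (s \<circ> a) c x2 permutes insert x2 H" using ins_permutes[OF pP c, of x2] fresh by auto
    have "a c \<in> orb (ins (s \<circ> a) c x2) (a e)"
      using orb_ins_mono[OF pP c, of x2 "a e" "a c"] e ae fresh by auto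
    then have "a c \<in> orb (?s1 \<circ> ?a1) (a e)"
      unfolding phi1 using orb_ins_mono[OF 1, of "a c" x1 "a e" "a c"] ac ae fresh by auto
    moreover have 2: "?s1 \<circ> ?a1 permutes ?H1" using pm1 by (auto simp: planar_map_def intro: permutes_compose)
    have 3: "ins (?s1 \<circ> ?a1) e y1 permutes insert y1 ?H1" by (rule ins_permutes[OF 2 eH]) (use fresh in auto)
    ultimately have "a c \<in> orb (ins (?s1 \<circ> ?a1) e y1) (a e)"
      by (intro orb_ins_mono[OF 2 eH]) (use ae fresh in auto)
    then have "a c \<in> orb (?s2 \<circ> ?a2) (a e)"
      unfolding phi2 using ae fresh v by (intro orb_ins_mono[OF 3]) auto
    then show ?thesis using v by simp
  qed
  have "planar_map (insert z' (insert z ?H2)) (?a2(z' := z, z := z'))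
      (?s2(y1 := z', z' := ?s2 y1, x2 := z, z := ?s2 x2))"
    by (rule planar_map_add_edge[OF pm2 _ _ _ same]) (use fresh in auto)
  moreover have "?s2(y1 := z', z' := ?s2 y1, x2 := z, z := ?s2 x2) = attach_sg s x1 x2 y1 y2 z z'"
    using fresh by (auto simp: attach_sg_def fun_eq_iff)
  moreover have "insert z' (insert z ?H2) = H \<union> {x1, x2, y1, y2, z, z'}" by auto
  ultimately show ?thesis unfolding attach_al_def by simp
qed

lemma successively_orb:
  assumes "successively (\<lambda>u v. f v = u) (u # us)" "v \<in> set (u # us)"
  shows "u \<in> orb f v"
  using assms
proof (induction us arbitrary: v rule: rev_induct)
  case (snoc w us)
  have s: "successively (\<lambda>u v. f v = u) (u # us)" "f w = last (u # us)"
    using snoc.prems(1) successively_append_iff[of "\<lambda>u v. f v = u" "u # us" "[w]"] by simp_all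
  show ?case
  proof (cases "v \<in> set (u # us)")
    case True
    then show ?thesis by (rule snoc.IH[OF s(1)])
  next
    case False
    then have v: "v = w" using snoc.prems by auto
    have "f w \<in> set (u # us)" unfolding s(2) by (rule last_in_set) simp
    then have "u \<in> orb f (f w)" by (rule snoc.IH[OF s(1)])
    moreover have "orb f (f w) \<subseteq> orb f w" by (rule orb_subset) (simp add: orb_step)
    ultimately show ?thesis using v by auto
  qed
qed auto

definition ind :: "nat set \<Rightarrow> weight" where
  "ind S = (\<lambda>i. if i \<in> S then 1 else 0)"

definition minuscule_step :: "nat \<Rightarrow> weight \<Rightarrow> weight \<Rightarrow> bool" where
  "minuscule_step n x y \<longleftrightarrow> (\<exists>S\<subseteq>{1..n}. S \<noteq> {} \<and> S \<noteq> {1..n} \<and> wt_eq n y (\<lambda>i. x i + ind S i))"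

definition fund_step :: "nat \<Rightarrow> weight \<Rightarrow> weight \<Rightarrow> bool" where
  "fund_step n x y \<longleftrightarrow> (\<exists>b\<in>{1..<n}. wt_eq n y (\<lambda>i. x i + ind {1..b} i))"

definition inner :: "web \<Rightarrow> nat set" where
  "inner W = wd W \<union> set (cd W)"

text \<open>Read on faces: being joined to the marked face by a path of steps that add exactly a fundamental
weight, respectively being joined by such a path to an external face.\<close>

inductive reach :: "nat \<Rightarrow> web \<Rightarrow> (nat \<Rightarrow> weight) \<Rightarrow> nat \<Rightarrow> bool" for n W \<delta> where
  reach_hd: "reach n W \<delta> (hd (cd W))"
| reach_phi: "reach n W \<delta> d \<Longrightarrow> d \<in> inner W \<Longrightarrow> reach n W \<delta> (phi W d)"
| reach_al: "reach n W \<delta> d \<Longrightarrow> d \<in> wd W \<Longrightarrow> fund_step n (\<delta> d) (\<delta> (al W d)) \<Longrightarrow> reach n W \<delta> (al W d)"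

inductive coreach :: "nat \<Rightarrow> web \<Rightarrow> (nat \<Rightarrow> weight) \<Rightarrow> nat \<Rightarrow> bool" for n W \<delta> where
  coreach_cd: "d \<in> set (cd W) \<Longrightarrow> coreach n W \<delta> d"
| coreach_phi: "coreach n W \<delta> (phi W d) \<Longrightarrow> d \<in> inner W \<Longrightarrow> coreach n W \<delta> d"
| coreach_al: "coreach n W \<delta> (al W d) \<Longrightarrow> d \<in> wd W \<Longrightarrow> fund_step n (\<delta> d) (\<delta> (al W d)) \<Longrightarrow> coreach n W \<delta> d"

definition potential :: "nat \<Rightarrow> web \<Rightarrow> (nat \<Rightarrow> weight) \<Rightarrow> bool" where
  "potential n W \<delta> \<longleftrightarrow>
     (\<forall>d\<in>inner W. \<delta> (phi W d) = \<delta> d \<and> reach n W \<delta> d \<and> coreach n W \<delta> d) \<and>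
     (\<forall>d\<in>wd W. minuscule_step n (\<delta> d) (\<delta> (al W d)))"

lemma wt_eq_refl [simp]: "wt_eq n x x"
  unfolding wt_eq_def by (rule exI[of _ 0]) simp

lemma wt_eq_sym: "wt_eq n x y \<Longrightarrow> wt_eq n y x"
  unfolding wt_eq_def by (metis add.commute add.inverse_inverse add_uminus_conv_diff diff_add_cancel)

lemma wt_eq_trans: "wt_eq n x y \<Longrightarrow> wt_eq n y z \<Longrightarrow> wt_eq n x z"
  unfolding wt_eq_def by (metis add.assoc)

lemma minuscule_step_sym: "minuscule_step n x y \<Longrightarrow> minuscule_step n y x"
proof -
  assume "minuscule_step n x y"
  then obtain S c where S: "S \<subseteq> {1..n}" "S \<noteq> {}" "S \<noteq> {1..n}" "\<forall>i\<in>{1..n}. y i = x i + ind S i + c"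
    unfolding minuscule_step_def wt_eq_def by blast
  then have "wt_eq n x (\<lambda>i. y i + ind ({1..n} - S) i)"
    unfolding wt_eq_def by (intro exI[of _ "- c - 1"]) (auto simp: ind_def)
  then show ?thesis unfolding minuscule_step_def using S by (intro exI[of _ "{1..n} - S"]) auto
qed

lemma fund_imp_minuscule: "fund_step n x y \<Longrightarrow> minuscule_step n x y"
proof -
  assume "fund_step n x y"
  then obtain b where b: "b \<in> {1..<n}" "wt_eq n y (\<lambda>i. x i + ind {1..b} i)" by (auto simp: fund_step_def)
  then have "n \<notin> {1..b}" "n \<in> {1..n}" by auto
  then have "{1..b} \<noteq> {1..n}" by blast
  moreover have "{1..b} \<subseteq> {1..n}" "{1..b} \<noteq> {}" using b(1) by auto
  ultimately show ?thesis unfolding minuscule_step_def using b(2)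
    by (intro exI[of _ "{1..b}"]) simp
qed

lemma chain_up: "successively (\<lambda>u v. R u \<longrightarrow> R v) (u # us) \<Longrightarrow> R u \<Longrightarrow> v \<in> set (u # us) \<Longrightarrow> R v"
  by (induction us arbitrary: u) auto

lemma chain_down:
  assumes "successively (\<lambda>u v. R v \<longrightarrow> R u) us" "us \<noteq> []" "R (last us)" "v \<in> set us"
  shows "R v"
proof -
  obtain w ws where w: "rev us = w # ws" using assms(2) by (metis list.exhaust rev_is_Nil_conv)
  have "successively (\<lambda>u v. R u \<longrightarrow> R v) (w # ws)"
    unfolding w[symmetric] successively_rev by (rule assms(1))
  moreover have "R w" using assms(2,3) w by (metis hd_rev list.sel(1))
  moreover have "v \<in> set (w # ws)" using assms(4) w by (metis set_rev)
  ultimately show ?thesis by (rule chain_up)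
qed

lemma successively_Cons_mono:
  "successively P (u # us) \<Longrightarrow> (\<And>a b. a \<in> set (u # us) \<Longrightarrow> b \<in> set us \<Longrightarrow> P a b \<Longrightarrow> Q a b) \<Longrightarrow>
    successively Q (u # us)"
  by (induction us arbitrary: u) auto

lemma successively_snoc_mono:
  "successively P (us @ [w]) \<Longrightarrow> (\<And>a b. a \<in> set us \<Longrightarrow> b \<in> set (us @ [w]) \<Longrightarrow> P a b \<Longrightarrow> Q a b) \<Longrightarrow>
    successively Q (us @ [w])"
proof (induction us)
  case (Cons u us)
  have "hd (us @ [w]) \<in> set (us @ [w])" by (rule hd_in_set) simp
  then show ?case using Cons by (auto simp: successively_Cons)
qed simp

lemma successively_conj:
  "successively P us \<Longrightarrow> successively Q us \<Longrightarrow> successively (\<lambda>u v. P u v \<and> Q u v) us"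
  by (induction us) (auto simp: successively_Cons)

lemma successively_pred: "successively P (u # us) \<Longrightarrow> v \<in> set us \<Longrightarrow> \<exists>w\<in>set (butlast (u # us)). P w v"
  by (induction us arbitrary: u) (auto split: if_splits)

locale disk =
  fixes W :: web
  assumes disk: "disk_map W"
begin

lemma
  shows cd_nonempty: "cd W \<noteq> []" and cd_distinct: "distinct (cd W)"
    and cd_wd: "u \<in> set (cd W) \<Longrightarrow> u \<notin> wd W"
    and al_cd_wd: "u \<in> set (cd W) \<Longrightarrow> al W u \<notin> wd W"
    and al_cd_cd: "u \<in> set (cd W) \<Longrightarrow> al W u \<notin> set (cd W)"
    and al_wd: "d \<in> wd W \<Longrightarrow> al W d \<in> wd W"
    and planar: "planar_map (darts W) (al W) (sg W)"
    and arcs: "successively (arc W) (cd W)"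
    and triv: "d \<in> darts W \<Longrightarrow> d \<noteq> hd (cd W) \<Longrightarrow> d \<noteq> al W (last (cd W)) \<Longrightarrow> sg W d \<noteq> d \<and> sg W (sg W (sg W d)) = d"
    and sg_hd: "sg W (hd (cd W)) = al W (last (cd W))" and sg_last: "sg W (al W (last (cd W))) = hd (cd W)"
  using disk unfolding disk_map_def by blast+

lemma al_al [simp]: "al W (al W d) = d"
  using planar by (auto simp: planar_map_def)

lemma al_eq_iff [simp]: "al W u = al W v \<longleftrightarrow> u = v"
  by (metis al_al)

lemma finite_darts: "finite (darts W)"
  using planar by (auto simp: planar_map_def)

lemma al_fixfree: "d \<in> darts W \<Longrightarrow> al W d \<noteq> d"
  using planar by (auto simp: planar_map_def)

lemma sg_perm: "sg W permutes darts W" and al_perm: "al W permutes darts W"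
  using planar by (auto simp: planar_map_def)

lemma sg_darts [simp]: "sg W d \<in> darts W \<longleftrightarrow> d \<in> darts W" and al_darts [simp]: "al W d \<in> darts W \<longleftrightarrow> d \<in> darts W"
  using sg_perm al_perm by (auto simp: permutes_in_image)

lemma cd_darts: "u \<in> set (cd W) \<Longrightarrow> u \<in> darts W" and wd_darts: "d \<in> wd W \<Longrightarrow> d \<in> darts W"
  by (auto simp: darts_def)

lemma al_wd_iff [simp]: "al W d \<in> wd W \<longleftrightarrow> d \<in> wd W"
  using al_wd al_al by metis

lemma arc_next:
  assumes "u \<in> set (cd W)" "u \<noteq> last (cd W)" obtains v where "v \<in> set (cd W)" "arc W u v"
proof -
  obtain ps qs where q: "cd W = ps @ u # qs" using assms(1) by (auto dest: split_list)
  moreover have "qs \<noteq> []" using q assms(2) by auto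
  ultimately obtain v qs' where "cd W = ps @ u # v # qs'" by (cases qs) auto
  then show ?thesis using that[of v] arcs by (auto simp: successively_append_iff)
qed

lemma inner_phi: "d \<in> inner W \<Longrightarrow> phi W d \<in> inner W"
proof -
  assume "d \<in> inner W"
  then consider "d \<in> wd W" | "d = last (cd W)" | "d \<in> set (cd W)" "d \<noteq> last (cd W)" by (auto simp: inner_def)
  then show ?thesis
  proof cases
    case 1
    show ?thesis
    proof (rule ccontr)
      assume n: "phi W d \<notin> inner W"
      have b: "al W d \<in> wd W" using 1 by simp
      have "phi W d \<in> darts W" using 1 wd_darts by (simp add: phi_def)
      then obtain u where u: "u \<in> set (cd W)" "sg W (al W d) = al W u"
        using n by (auto simp: darts_def inner_def phi_def)
      have "\<exists>v\<in>set (cd W). sg W v = al W u"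
      proof (cases "u = last (cd W)")
        case True
        then show ?thesis using sg_hd cd_nonempty by (intro bexI[of _ "hd (cd W)"]) auto
      next
        case False
        then show ?thesis using arc_next[OF u(1)] by (metis arc_def)
      qed
      then show False using u(2) b cd_wd injD[OF permutes_inj[OF sg_perm]] by metis
    qed
  next
    case 2
    then show ?thesis using sg_last cd_nonempty by (simp add: phi_def inner_def)
  next
    case 3
    then show ?thesis using arc_next by (metis arc_def comp_apply phi_def UnI1 inner_def)
  qed
qed

end

locale cone = disk +
  fixes xs ms zs :: "nat list" and c e x1 x2 y1 y2 z z' :: nat
  assumes cd_eq: "cd W = xs @ c # ms @ e # zs"
    and fresh: "distinct [x1, x2, y1, y2, z, z']" "set [x1, x2, y1, y2, z, z'] \<inter> darts W = {}"
begin

text \<open>The new outer edge runs around the old boundary arcs \<open>c\<close>, \<open>ms\<close>, \<open>e\<close>: it becomes a boundary arc, while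
the pieces of the old circle between its end points become web edges.  Dually, a new external vertex
is joined to the external vertices of \<open>c\<close>, \<open>ms\<close>, \<open>e\<close>.  With \<open>ms\<close> of length 1 and 0 this prepends an H
and a merging of two strands.\<close>

definition V :: web where
  "V = \<lparr>wd = wd W \<union> {x2, al W c, e, y2} \<union> set ms \<union> al W ` set ms, cd = xs @ c # z # y1 # zs,
        al = attach_al (al W) c e x1 x2 y1 y2 z z', sg = attach_sg (sg W) x1 x2 y1 y2 z z', lab = lab W\<rparr>"

lemma new_notin: "x1 \<notin> darts W" "x2 \<notin> darts W" "y1 \<notin> darts W" "y2 \<notin> darts W" "z \<notin> darts W" "z' \<notin> darts W"
  using fresh by auto

lemma ce: "c \<in> set (cd W)" "e \<in> set (cd W)" "c \<noteq> e" "c \<noteq> al W c" "c \<noteq> al W e" "e \<noteq> al W c" "e \<noteq> al W e"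
    "al W c \<noteq> c" "al W c \<noteq> e" "al W e \<noteq> c" "al W e \<noteq> e" "e \<noteq> c"
proof -
  show ce: "c \<in> set (cd W)" "e \<in> set (cd W)" by (simp_all add: cd_eq)
  show "c \<noteq> e" using cd_distinct by (simp add: cd_eq)
  then show "e \<noteq> c" by simp
  show "c \<noteq> al W c" "c \<noteq> al W e" "e \<noteq> al W c" "e \<noteq> al W e" "al W c \<noteq> c" "al W c \<noteq> e" "al W e \<noteq> c" "al W e \<noteq> e"
    using ce al_cd_cd by metis+
qed

lemma ce_darts: "c \<in> darts W" "e \<in> darts W" "al W c \<in> darts W" "al W e \<in> darts W"
  using ce cd_darts by auto

lemma new_ne: 
  assumes "d \<in> darts W" shows "d \<noteq> x1" "d \<noteq> x2" "d \<noteq> y1" "d \<noteq> y2" "d \<noteq> z" "d \<noteq> z'"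
    "x1 \<noteq> d" "x2 \<noteq> d" "y1 \<noteq> d" "y2 \<noteq> d" "z \<noteq> d" "z' \<noteq> d"
  using new_notin assms by auto

lemma sg_V [simp]: "sg V x1 = x2" "sg V x2 = z" "sg V z = x1" "sg V z' = y2" "sg V y2 = y1" "sg V y1 = z'"
  using fresh by (auto simp: V_def attach_sg_def)

lemma sg_V_old: "d \<in> darts W \<Longrightarrow> sg V d = sg W d"
  using new_ne[of d] by (auto simp: V_def attach_sg_def)

lemma fresh_ne:
  "x1 \<noteq> x2" "x1 \<noteq> y1" "x1 \<noteq> y2" "x1 \<noteq> z" "x1 \<noteq> z'" "x2 \<noteq> y1" "x2 \<noteq> y2" "x2 \<noteq> z" "x2 \<noteq> z'"
  "y1 \<noteq> y2" "y1 \<noteq> z" "y1 \<noteq> z'" "y2 \<noteq> z" "y2 \<noteq> z'" "z \<noteq> z'"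
  using fresh(1) by auto

lemma al_V [simp]: "al V c = x1" "al V x1 = c" "al V x2 = al W c" "al V (al W c) = x2" "al V e = y2" "al V y2 = e"
   "al V y1 = al W e" "al V (al W e) = y1" "al V z = z'" "al V z' = z"
  using fresh_ne fresh_ne[symmetric] ce(3-) ce_darts[THEN new_ne(1)] ce_darts[THEN new_ne(2)] ce_darts[THEN new_ne(3)]
    ce_darts[THEN new_ne(4)] ce_darts[THEN new_ne(5)] ce_darts[THEN new_ne(6)]
  by (simp_all add: V_def attach_al_def sub_al_def)

lemma al_V_old:
  assumes "d \<in> darts W" "d \<notin> {c, e, al W c, al W e}" shows "al V d = al W d"
proof -
  have "sub_al (al W) c x1 x2 e = al W e" 
    using ce(3-) ce_darts[THEN new_ne(1)] ce_darts[THEN new_ne(2)] by (simp add: sub_al_def)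
  then show ?thesis using assms new_ne[OF assms(1)] by (simp add: V_def attach_al_def sub_al_def)
qed

lemma cd_V: "cd V = xs @ c # z # y1 # zs"
  and wd_V: "wd V = wd W \<union> {x2, al W c, e, y2} \<union> set ms \<union> al W ` set ms"
  by (auto simp: V_def)

lemma al_V_arc: "u \<in> set (cd W) \<Longrightarrow> u \<noteq> c \<Longrightarrow> u \<noteq> e \<Longrightarrow> al V u = al W u"
  using al_cd_cd ce(1,2) cd_darts by (intro al_V_old) auto

lemma al_V_wd: "d \<in> wd W \<Longrightarrow> al V d = al W d"
  using cd_wd al_cd_wd ce(1,2) wd_darts by (intro al_V_old) auto

lemma al_V_image: "al V ` set (cd V) = al W ` (set xs \<union> set zs) \<union> {x1, z', al W e}"
proof -
  have "al V u = al W u" if "u \<in> set xs \<union> set zs" for u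
    using that cd_eq cd_distinct by (intro al_V_arc) auto
  then show ?thesis by (auto simp: cd_V image_Un intro!: image_eqI)
qed

lemma darts_V: "darts V = darts W \<union> {x1, x2, y1, y2, z, z'}"
  unfolding darts_def[of V] al_V_image unfolding cd_V wd_V darts_def[of W] cd_eq by auto

lemma outer_orbit: "u \<in> set (c # ms @ [e]) \<Longrightarrow> al W c \<in> orb (sg W \<circ> al W) (al W u)"
proof -
  assume u: "u \<in> set (c # ms @ [e])"
  have "successively (arc W) (c # ms @ [e])"
    using arcs successively_append_iff[of "arc W" xs "(c # ms @ [e]) @ zs"]
      successively_append_iff[of "arc W" "c # ms @ [e]" zs] by (simp add: cd_eq)
  then have "successively (\<lambda>u v. (sg W \<circ> al W) v = u) (map (al W) (c # ms @ [e]))"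
    unfolding successively_map by (rule successively_mono) (auto simp: arc_def)
  from successively_orb[of _ "al W c" "map (al W) (ms @ [e])"] this u show ?thesis by auto
qed

lemma disk_V: "disk_map V"
proof -
  have sub: "set xs \<subseteq> darts W" "set ms \<subseteq> darts W" "set zs \<subseteq> darts W" "wd W \<subseteq> darts W"
     "al W ` set xs \<subseteq> darts W" "al W ` set ms \<subseteq> darts W" "al W ` set zs \<subseteq> darts W"
    using cd_darts wd_darts unfolding cd_eq by auto
  have D: "distinct (xs @ c # ms @ e # zs)" using cd_distinct cd_eq by simp
  have "planar_map (darts V) (al V) (sg V)"
    unfolding darts_V using planar_map_attach[OF planar ce_darts(1) fresh, of e] ce ce_darts(2) outer_orbit[of e]
    by (auto simp: V_def)
  moreover have "distinct (cd V)" using D new_notin sub fresh(1) ce_darts by (auto simp: cd_V)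
  moreover have "wd V \<inter> set (cd V) = {}" "wd V \<inter> al V ` set (cd V) = {}" "set (cd V) \<inter> al V ` set (cd V) = {}"
  proof -
    define C M where "C = set (cd W)" and "M = set ms"
    have "set xs \<union> set zs = C - (M \<union> {c, e})" using D by (auto simp: C_def M_def cd_eq)
    then have cdV: "set (cd V) = (C - (M \<union> {e})) \<union> {z, y1}" 
      and acdV: "al V ` set (cd V) = al W ` (C - (M \<union> {c})) \<union> {x1, z'}"
      unfolding al_V_image unfolding cd_V using ce(1-3) D by (auto simp: C_def M_def cd_eq)
    have wdV: "wd V = wd W \<union> {e} \<union> M \<union> al W ` (M \<union> {c}) \<union> {x2, y2}"
      by (auto simp: wd_V M_def)
    have C: "M \<union> {c, e} \<subseteq> C" "wd W \<inter> C = {}" "wd W \<inter> al W ` C = {}" "C \<inter> al W ` C = {}"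
    proof -
      show "M \<union> {c, e} \<subseteq> C" by (auto simp: C_def M_def cd_eq)
      show "wd W \<inter> C = {}" "wd W \<inter> al W ` C = {}" "C \<inter> al W ` C = {}"
        unfolding C_def using cd_wd al_cd_wd al_cd_cd by blast+
    qed
    have new: "{x1, x2, y1, y2, z, z'} \<inter> (wd W \<union> C \<union> al W ` C) = {}"
      using fresh(2) by (auto simp: darts_def C_def)
    define E where "E = al W ` C"
    define N where "N = {x1, x2, y1, y2, z, z'}"
    have r: "d \<in> wd W \<Longrightarrow> d \<notin> C \<and> d \<notin> E \<and> d \<notin> N" "d \<in> C \<Longrightarrow> d \<notin> E \<and> d \<notin> N" "d \<in> E \<Longrightarrow> d \<notin> N"
       "d \<in> {x2, y2} \<Longrightarrow> d \<in> N \<and> d \<notin> {z, y1} \<and> d \<notin> {x1, z'}"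
       "d \<in> {z, y1} \<Longrightarrow> d \<in> N \<and> d \<notin> {x1, z'}" "d \<in> {x1, z'} \<Longrightarrow> d \<in> N" for d
      using C new fresh_ne unfolding E_def[symmetric] N_def[symmetric] by (blast, blast, blast, auto simp: N_def)
    have 1: "d \<in> wd W \<or> d \<in> C \<and> d \<in> M \<union> {e} \<or> d \<in> E \<and> d \<in> al W ` (M \<union> {c}) \<or> d \<in> {x2, y2}" if "d \<in> wd V" for d
      using that C(1) unfolding wdV E_def by blast
    have 2: "d \<in> C \<and> d \<notin> M \<union> {e} \<or> d \<in> {z, y1}" if "d \<in> set (cd V)" for d
      using that unfolding cdV by blast
    have 3: "d \<in> E \<and> d \<notin> al W ` (M \<union> {c}) \<or> d \<in> {x1, z'}" if "d \<in> al V ` set (cd V)" for d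
      using that unfolding acdV E_def by auto
    show "wd V \<inter> al V ` set (cd V) = {}" using 1 3 r by (intro equals0I) (metis IntD1 IntD2)
    show "wd V \<inter> set (cd V) = {}" using 1 2 r by (intro equals0I) (metis IntD1 IntD2)
    show "set (cd V) \<inter> al V ` set (cd V) = {}" using 2 3 r by (intro equals0I) (metis IntD1 IntD2)
  qed
  moreover have "\<forall>d\<in>wd V. al V d \<in> wd V"
  proof
    fix d assume "d \<in> wd V"
    then consider "d \<in> wd W" | "d \<in> {x2, al W c, e, y2}" | u where "u \<in> set ms" "d = u \<or> d = al W u"
      unfolding wd_V by blast
    then show "al V d \<in> wd V"
    proof cases
      case 3
      then have "u \<in> set (cd W)" "u \<noteq> c" "u \<noteq> e" using D by (auto simp: cd_eq)
      then have "al V u = al W u" "al V (al W u) = u"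
        using ce(1,2) al_cd_cd[of u] cd_darts al_V_old[of "al W u"] by (auto intro: al_V_arc)
      then show ?thesis using 3 by (auto simp: wd_V)
    qed (auto simp: wd_V al_V_wd)
  qed
  moreover have hd: "hd (cd V) = hd (cd W)" unfolding cd_eq cd_V by (cases xs) auto
  moreover have last: "al V (last (cd V)) = al W (last (cd W))"
  proof (cases "zs = []")
    case True
    moreover have "last (cd V) = (if zs = [] then y1 else last zs)" "last (cd W) = (if zs = [] then e else last zs)"
      by (simp_all add: cd_V cd_eq)
    ultimately show ?thesis using al_V(7) by metis
  next
    case False
    then have "last zs \<noteq> c" "last zs \<noteq> e" "last zs \<in> set (cd W)" using D by (auto simp: cd_eq)
    then show ?thesis using al_V_arc[of "last zs"] False by (simp add: cd_V cd_eq)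
  qed
  moreover have "sg V (hd (cd W)) = al W (last (cd W))" "sg V (al W (last (cd W))) = hd (cd W)"
    using sg_hd sg_last cd_nonempty sg_V_old cd_darts by simp_all
  moreover have "\<forall>d\<in>darts V - {hd (cd W), al W (last (cd W))}. sg V d \<noteq> d \<and> sg V (sg V (sg V d)) = d"
    using triv fresh by (auto simp: darts_V sg_V_old)
  moreover have "successively (arc V) (cd V)"
  proof -
    have old: "arc V u v" if "arc W u v" "u \<in> set (cd W)" "u \<noteq> c" "u \<noteq> e" "v \<in> set (cd W)" for u v
      using that al_V_arc[of u] by (auto simp: arc_def sg_V_old cd_darts wd_V wd_darts)
    have ch: "successively (arc W) (xs @ [c])" "successively (arc W) zs" "zs \<noteq> [] \<Longrightarrow> arc W e (hd zs)"
      using arcs unfolding cd_eq by (auto simp: successively_append_iff successively_Cons)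
    have ch': "successively (arc W) xs" using ch(1) by (simp add: successively_append_iff)
    have "successively (arc V) xs" by (rule successively_mono[OF ch']) (rule old, use D cd_eq in auto)
    moreover have "successively (arc V) zs" by (rule successively_mono[OF ch(2)]) (rule old, use D cd_eq in auto)
    moreover have "xs \<noteq> [] \<Longrightarrow> arc V (last xs) c"
      using ch(1) D by (intro old) (auto simp: successively_append_iff cd_eq)
    moreover have "arc V c z" "arc V z y1" by (auto simp: arc_def wd_V)
    moreover have "arc V y1 (hd zs)" if "zs \<noteq> []"
      using ch(3)[OF that] that by (auto simp: arc_def sg_V_old ce_darts wd_V cd_darts cd_eq)
    ultimately show ?thesis by (auto simp: cd_V successively_append_iff successively_Cons)
  qed
  ultimately show ?thesis unfolding disk_map_def by (simp add: cd_V)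
qed

definition \<delta>V :: "(nat \<Rightarrow> weight) \<Rightarrow> weight \<Rightarrow> nat \<Rightarrow> weight" where
  "\<delta>V \<delta> p d = (if d \<in> {z, y2} \<union> al W ` set (c # ms) then p
     else if d = x2 then \<delta> c else if d = y1 then \<delta> e else \<delta> d)"

lemma inner_darts: "inner W \<subseteq> darts W"
  by (auto simp: inner_def darts_def)

lemma inner_V: "inner V = inner W \<union> {x2, y2, z, y1} \<union> al W ` set (c # ms)"
  unfolding inner_def cd_V wd_V cd_eq by auto

lemma \<delta>V_inner: "d \<in> inner W \<Longrightarrow> \<delta>V \<delta> p d = \<delta> d"
proof -
  assume d: "d \<in> inner W"
  then have "d \<notin> al W ` set (cd W)" using al_cd_cd al_cd_wd by (auto simp: inner_def)
  then have "d \<notin> al W ` set (c # ms)" by (auto simp: cd_eq)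
  moreover have "d \<in> darts W" using d inner_darts by auto
  ultimately show ?thesis using new_ne[of d] by (simp add: \<delta>V_def)
qed

lemma \<delta>V_new: "\<delta>V \<delta> p z = p" "\<delta>V \<delta> p y2 = p" "u \<in> set (c # ms) \<Longrightarrow> \<delta>V \<delta> p (al W u) = p"
  "\<delta>V \<delta> p x2 = \<delta> c" "\<delta>V \<delta> p y1 = \<delta> e"
proof -
  have "al W ` set (c # ms) \<subseteq> darts W" using cd_darts unfolding cd_eq by auto
  then show "\<delta>V \<delta> p z = p" "\<delta>V \<delta> p y2 = p" "u \<in> set (c # ms) \<Longrightarrow> \<delta>V \<delta> p (al W u) = p"
    "\<delta>V \<delta> p x2 = \<delta> c" "\<delta>V \<delta> p y1 = \<delta> e"
    using fresh_ne new_notin unfolding \<delta>V_def by (auto simp: subset_iff)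
qed

lemma phi_V: "phi V c = x2" "phi V x2 = phi W c" "phi V e = y1" "phi V y1 = phi W e" "phi V z = y2"
  "phi V y2 = sg W e" "phi V (al W c) = z" "u \<in> set ms \<Longrightarrow> phi V (al W u) = sg W u"
  "d \<in> inner W \<Longrightarrow> d \<noteq> c \<Longrightarrow> d \<noteq> e \<Longrightarrow> phi V d = phi W d"
proof -
  show "phi V c = x2" "phi V x2 = phi W c" "phi V e = y1" "phi V y1 = phi W e" "phi V z = y2"
    "phi V y2 = sg W e" "phi V (al W c) = z"
    using ce_darts by (simp_all add: phi_def sg_V_old)
  assume u: "u \<in> set ms"
  then have uc: "u \<in> set (cd W)" "u \<noteq> c" "u \<noteq> e" using cd_distinct by (auto simp: cd_eq)
  then have "al V (al W u) = u"
    using ce(1,2) al_cd_cd[of u] cd_darts al_V_old[of "al W u"] by auto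
  then show "phi V (al W u) = sg W u" using uc cd_darts by (simp add: phi_def sg_V_old)
next
  assume d: "d \<in> inner W" "d \<noteq> c" "d \<noteq> e"
  then have "d \<notin> {c, e, al W c, al W e}" "d \<in> darts W"
    using al_cd_cd al_cd_wd ce(1,2) inner_darts by (auto simp: inner_def)
  then show "phi V d = phi W d" by (simp add: phi_def sg_V_old al_V_old)
qed

lemma sg_chain: "successively (\<lambda>u v. sg W v = al W u) (c # ms @ [e])"
proof -
  have "successively (arc W) (c # ms @ [e])"
    using arcs successively_append_iff[of "arc W" xs "(c # ms @ [e]) @ zs"]
      successively_append_iff[of "arc W" "c # ms @ [e]" zs] by (simp add: cd_eq)
  then show ?thesis by (rule successively_mono) (auto simp: arc_def)
qed

lemma potential_V:
  assumes pot: "potential n W \<delta>" and fund: "fund_step n (\<delta> c) p"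
    and adj: "\<forall>u\<in>set (c # ms @ [e]). minuscule_step n (\<delta> u) p"
    and up: "successively (\<lambda>u v. fund_step n (\<delta> u) (\<delta> v)) (ms @ [e])"
  shows "potential n V (\<delta>V \<delta> p)"
proof -
  let ?\<delta> = "\<delta>V \<delta> p"
  have cei: "c \<in> inner W" "e \<in> inner W" using ce by (auto simp: inner_def)
  have inV: "inner W \<subseteq> inner V" "{x2, y2, z, y1} \<subseteq> inner V" "al W ` set (c # ms) \<subseteq> inner V"
    by (auto simp: inner_V)
  have wdV: "wd W \<subseteq> wd V" by (auto simp: wd_V)
  have const: "?\<delta> (phi V d) = ?\<delta> d" if d: "d \<in> inner V" for d
  proof -
    have sgm: "?\<delta> (sg W v) = p" if "v \<in> set (ms @ [e])" for v
      using successively_pred[OF sg_chain that] \<delta>V_new(3) by (auto simp: butlast_append)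
    consider "d = c" | "d = x2" | "d = e" | "d = y1" | "d = z" | "d = y2" | "d = al W c" | u where "u \<in> set ms" "d = al W u"
      | "d \<in> inner W" "d \<noteq> c" "d \<noteq> e"
      using d unfolding inner_V by auto
    then show ?thesis
      by cases (use sgm cei pot in \<open>auto simp: phi_V \<delta>V_new \<delta>V_inner inner_phi potential_def\<close>)
  qed
  have reach_old: "reach n V ?\<delta> d \<and> d \<in> inner W" if "reach n W \<delta> d" for d
    using that
  proof (induction rule: reach.induct)
    case reach_hd
    have "hd (cd V) = hd (cd W)" unfolding cd_eq cd_V by (cases xs) auto
    then show ?case using cd_nonempty reach.reach_hd[of n V ?\<delta>] by (simp add: inner_def)
  next
    case (reach_phi d)
    have "reach n V ?\<delta> (phi V d)" "reach n V ?\<delta> (phi V (phi V d))" if "d \<in> {c, e}"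
      using that reach_phi inV by (auto simp: phi_V intro!: reach.reach_phi)
    moreover have "reach n V ?\<delta> (phi W d)" if "d \<notin> {c, e}"
      using that reach.reach_phi[of n V ?\<delta> d] phi_V(9)[of d] reach_phi inV by auto
    ultimately show ?case using reach_phi inner_phi phi_V(1-4) by (cases "d \<in> {c, e}") auto
  next
    case (reach_al d)
    then have "d \<in> inner W" "al W d \<in> inner W" by (auto simp: inner_def)
    then show ?case
      using reach_al reach.reach_al[of n V ?\<delta> d] wdV al_V_wd[of d] by (auto simp: \<delta>V_inner)
  qed
  have coreach_e: "coreach n V ?\<delta> e"
  proof (rule coreach_phi)
    show "coreach n V ?\<delta> (phi V e)" unfolding phi_V by (rule coreach_cd) (simp add: cd_V)
  qed (use inV cei in auto)
  have coreach_chain: "successively (\<lambda>u v. coreach n V ?\<delta> v \<longrightarrow> coreach n V ?\<delta> u) (ms @ [e])"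
  proof -
    have sa: "successively (arc W) (ms @ [e])"
      using arcs successively_append_iff[of "arc W" "xs @ [c]" "(ms @ [e]) @ zs"]
        successively_append_iff[of "arc W" "ms @ [e]" zs] by (simp add: cd_eq)
    have step: "coreach n V ?\<delta> v \<longrightarrow> coreach n V ?\<delta> u" if a: "arc W u v" "fund_step n (\<delta> u) (\<delta> v)"
      "u \<in> set ms" "v \<in> set (ms @ [e])" for u v
    proof
      assume v: "coreach n V ?\<delta> v"
      have uc: "u \<in> set (cd W)" "u \<noteq> c" "u \<noteq> e" "u \<in> inner W" using a(3) cd_distinct by (auto simp: cd_eq inner_def)
      define w where "w = sg W (al W u)"
      have w: "w \<in> wd W" "sg W w = v" "phi V u = w" "phi W u = w"
        using a(1) phi_V(9)[of u] uc by (auto simp: w_def arc_def phi_def)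
      have aw: "al W w \<in> wd W" "al W w \<in> inner W" "w \<in> inner W" using w by (auto simp: inner_def)
      then have "al W w \<noteq> c" "al W w \<noteq> e" using ce(1,2) cd_wd by metis+
      then have pw: "phi V (al W w) = v" "phi W (al W w) = v" using aw phi_V(9)[of "al W w"] w by (auto simp: phi_def)
      then have "coreach n V ?\<delta> (al W w)" using v aw inV by (auto intro: coreach_phi)
      moreover have "\<delta> (al W w) = \<delta> v" "\<delta> w = \<delta> u"
        using pot pw w aw uc by (auto simp: potential_def)
      ultimately have "coreach n V ?\<delta> w"
        using coreach_al[of n V ?\<delta> w] w(1) subsetD[OF wdV w(1)] al_V_wd[OF w(1)] aw a(2)
        by (simp add: \<delta>V_inner)
      then show "coreach n V ?\<delta> u" using w uc inV by (auto intro: coreach_phi)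
    qed
    show ?thesis
      by (rule successively_snoc_mono[OF successively_conj[OF sa up]]) (rule step, auto)
  qed
  have coreach_ms: "coreach n V ?\<delta> u" if "u \<in> set (ms @ [e])" for u
    by (rule chain_down[OF coreach_chain _ _ that]) (use coreach_e in auto)
  have coreach_old: "coreach n V ?\<delta> d" if "coreach n W \<delta> d" for d
    using that
  proof (induction rule: coreach.induct)
    case (coreach_cd d)
    then have "d \<in> set (cd V) \<or> d \<in> set (ms @ [e])" unfolding cd_V cd_eq by auto
    then show ?case using coreach_ms by (auto intro: coreach.coreach_cd)
  next
    case (coreach_phi d)
    have "coreach n V ?\<delta> (phi V d)" if "d \<in> {c, e}"
      using that coreach_phi inV by (auto simp: phi_V intro!: coreach.coreach_phi[of _ _ _ x2] coreach.coreach_phi[of _ _ _ y1])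
    moreover have "coreach n V ?\<delta> (phi V d)" if "d \<notin> {c, e}"
      using that phi_V(9)[of d] coreach_phi by auto
    ultimately show ?case using coreach_phi inV by (cases "d \<in> {c, e}") (auto intro: coreach.coreach_phi)
  next
    case (coreach_al d)
    then have "d \<in> inner W" "al W d \<in> inner W" by (auto simp: inner_def)
    then show ?case
      using coreach_al coreach.coreach_al[of n V ?\<delta> d] wdV al_V_wd[of d] by (auto simp: \<delta>V_inner)
  qed
  have allW: "reach n V ?\<delta> d \<and> coreach n V ?\<delta> d" if "d \<in> inner W" for d
    using that pot reach_old coreach_old by (auto simp: potential_def)
  have phic: "phi W c \<in> inner W" "phi W e \<in> inner W" using inner_phi cei by auto
  have rx2: "reach n V ?\<delta> x2" "reach n V ?\<delta> y1" 
    using reach_phi[of n V ?\<delta> c] reach_phi[of n V ?\<delta> e] allW cei inV by (auto simp: phi_V)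
  have rac: "reach n V ?\<delta> (al W c)"
    using reach_al[of n V ?\<delta> x2] rx2 fund by (auto simp: wd_V \<delta>V_new)
  have rz: "reach n V ?\<delta> z" using reach_phi[of n V ?\<delta> "al W c"] rac inV by (auto simp: phi_V)
  have ry: "reach n V ?\<delta> y2" using reach_phi[of n V ?\<delta> z] rz inV by (auto simp: phi_V)
  have se: "sg W e = al W (last (c # ms))"
    using sg_chain successively_append_iff[of _ "c # ms" "[e]"] by simp
  have rl: "reach n V ?\<delta> (al W (last (c # ms)))"
    using reach_phi[of n V ?\<delta> y2] ry inV by (auto simp: phi_V se)
  have sub: "successively (\<lambda>u v. sg W v = al W u) (c # ms)"
    using sg_chain successively_append_iff[of _ "c # ms" "[e]"] by simp
  have phim: "phi V (al W v) = al W u" if "sg W v = al W u" "v \<in> set ms" for u v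
    using that by (simp add: phi_V)
  have alm: "al W v \<in> inner V" if "v \<in> set ms" for v using that inV(3) by auto
  have "reach n V ?\<delta> (al W u)" if "sg W v = al W u" "v \<in> set ms" "reach n V ?\<delta> (al W v)" for u v
    using reach_phi[OF that(3) alm[OF that(2)]] phim[OF that(1,2)] by simp
  then have "successively (\<lambda>u v. reach n V ?\<delta> (al W v) \<longrightarrow> reach n V ?\<delta> (al W u)) (c # ms)"
    by (intro successively_Cons_mono[OF sub]) blast
  from chain_down[OF this _ rl] have rm: "\<forall>u\<in>set (c # ms). reach n V ?\<delta> (al W u)" by blast
  have cc: "coreach n V ?\<delta> (al W c)"
    using coreach_phi[of n V ?\<delta> "al W c"] coreach_cd[of z V n ?\<delta>] inV by (auto simp: phi_V cd_V)
  have "coreach n V ?\<delta> (al W v)" if "sg W v = al W u" "v \<in> set ms" "coreach n V ?\<delta> (al W u)" for u v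
    using coreach_phi[OF _ alm[OF that(2)]] phim[OF that(1,2)] that(3) by simp
  then have "successively (\<lambda>u v. coreach n V ?\<delta> (al W u) \<longrightarrow> coreach n V ?\<delta> (al W v)) (c # ms)"
    by (intro successively_Cons_mono[OF sub]) blast
  from chain_up[OF this cc] have cm: "coreach n V ?\<delta> (al W u)" if "u \<in> set (c # ms)" for u
    using that by blast
  have cnew: "coreach n V ?\<delta> x2" "coreach n V ?\<delta> y1" "coreach n V ?\<delta> z" "coreach n V ?\<delta> y2"
  proof -
    show "coreach n V ?\<delta> x2" using coreach_phi[of n V ?\<delta> x2] allW phic inV by (auto simp: phi_V)
    show "coreach n V ?\<delta> y1" "coreach n V ?\<delta> z" by (auto intro: coreach_cd simp: cd_V)
    show "coreach n V ?\<delta> y2"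
      using coreach_phi[of n V ?\<delta> y2] cm[of "last (c # ms)"] inV by (auto simp: phi_V se)
  qed
  have steps: "minuscule_step n (?\<delta> d) (?\<delta> (al V d))" if d: "d \<in> wd V" for d
  proof -
    have adj': "minuscule_step n (\<delta> u) p" "minuscule_step n p (\<delta> u)" if "u \<in> set (c # ms @ [e])" for u
      using adj that minuscule_step_sym by blast+
    consider "d \<in> wd W" | "d \<in> {x2, al W c, e, y2}" | u where "u \<in> set ms" "d = u \<or> d = al W u"
      using d unfolding wd_V by blast
    then show ?thesis
    proof cases
      case 1
      then have "d \<in> inner W" "al W d \<in> inner W" by (auto simp: inner_def)
      then show ?thesis using 1 pot by (simp add: \<delta>V_inner al_V_wd potential_def)
    next
      case 2
      then show ?thesis using adj' cei by (auto simp: \<delta>V_new \<delta>V_inner)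
    next
      case 3
      then have u: "u \<in> set (cd W)" "u \<noteq> c" "u \<noteq> e" "u \<in> inner W" 
        using cd_distinct by (auto simp: cd_eq inner_def)
      then have "al V u = al W u" "al V (al W u) = u"
        using ce(1,2) al_cd_cd[of u] cd_darts al_V_old[of "al W u"] by (auto intro: al_V_arc)
      then show ?thesis using 3 adj'[of u] u by (auto simp: \<delta>V_new \<delta>V_inner)
    qed
  qed
  show ?thesis unfolding potential_def
    using const steps allW rx2 rz ry rm cm cnew by (auto simp: inner_V)
qed

end

locale cap = disk +
  fixes xs zs :: "nat list" and c x1 x2 y1 y2 z z' :: nat
  assumes cd_eq: "cd W = xs @ c # zs"
    and fresh: "distinct [x1, x2, y1, y2, z, z']" "set [x1, x2, y1, y2, z, z'] \<inter> darts W = {}"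
begin

text \<open>Here both end points of the new outer edge lie on the arc \<open>c\<close>, and the piece of \<open>c\<close> between them
becomes a strand of the web joining two adjacent boundary points.\<close>

definition V :: web where
  "V = \<lparr>wd = wd W \<union> {x2, y2}, cd = xs @ c # z # y1 # zs,
        al = attach_al (al W) c x2 x1 x2 y1 y2 z z', sg = attach_sg (sg W) x1 x2 y1 y2 z z', lab = lab W\<rparr>"

lemma new_ne: 
  assumes "d \<in> darts W" shows "d \<noteq> x1" "d \<noteq> x2" "d \<noteq> y1" "d \<noteq> y2" "d \<noteq> z" "d \<noteq> z'"
    "x1 \<noteq> d" "x2 \<noteq> d" "y1 \<noteq> d" "y2 \<noteq> d" "z \<noteq> d" "z' \<noteq> d"
  using fresh assms by auto

lemma fresh_ne:
  "x1 \<noteq> x2" "x1 \<noteq> y1" "x1 \<noteq> y2" "x1 \<noteq> z" "x1 \<noteq> z'" "x2 \<noteq> y1" "x2 \<noteq> y2" "x2 \<noteq> z" "x2 \<noteq> z'"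
  "y1 \<noteq> y2" "y1 \<noteq> z" "y1 \<noteq> z'" "y2 \<noteq> z" "y2 \<noteq> z'" "z \<noteq> z'"
  using fresh(1) by auto

lemma c_arc: "c \<in> set (cd W)" "c \<noteq> al W c" "al W c \<noteq> c"
proof -
  show c: "c \<in> set (cd W)" by (simp add: cd_eq)
  show "c \<noteq> al W c" "al W c \<noteq> c" using c al_cd_cd by metis+
qed

lemma c_darts: "c \<in> darts W" "al W c \<in> darts W"
  using c_arc cd_darts by auto

lemma sg_V [simp]: "sg V x1 = x2" "sg V x2 = z" "sg V z = x1" "sg V z' = y2" "sg V y2 = y1" "sg V y1 = z'"
  using fresh by (auto simp: V_def attach_sg_def)

lemma sg_V_old: "d \<in> darts W \<Longrightarrow> sg V d = sg W d"
  using new_ne[of d] by (auto simp: V_def attach_sg_def)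

lemma al_V [simp]: "al V c = x1" "al V x1 = c" "al V x2 = y2" "al V y2 = x2"
   "al V y1 = al W c" "al V (al W c) = y1" "al V z = z'" "al V z' = z"
  using fresh_ne fresh_ne[symmetric] c_arc(2-) c_darts[THEN new_ne(1)] c_darts[THEN new_ne(2)] c_darts[THEN new_ne(3)]
    c_darts[THEN new_ne(4)] c_darts[THEN new_ne(5)] c_darts[THEN new_ne(6)]
  by (simp_all add: V_def attach_al_def sub_al_def)

lemma al_V_old:
  assumes "d \<in> darts W" "d \<noteq> c" "d \<noteq> al W c" shows "al V d = al W d"
proof -
  have "sub_al (al W) c x1 x2 x2 = al W c" 
    using c_darts(2)[THEN new_ne(2)] by (simp add: sub_al_def)
  then show ?thesis using assms new_ne[OF assms(1)] by (simp add: V_def attach_al_def sub_al_def)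
qed

lemma cd_V: "cd V = xs @ c # z # y1 # zs" and wd_V: "wd V = wd W \<union> {x2, y2}"
  by (auto simp: V_def)

lemma al_V_arc: "u \<in> set (cd W) \<Longrightarrow> u \<noteq> c \<Longrightarrow> al V u = al W u"
  using al_cd_cd[of c] c_arc(1) cd_darts by (intro al_V_old) auto

lemma al_V_wd: "d \<in> wd W \<Longrightarrow> al V d = al W d"
  using cd_wd al_cd_wd c_arc(1) wd_darts by (intro al_V_old) auto

lemma al_V_image: "al V ` set (cd V) = al W ` set (cd W) \<union> {x1, z'}"
proof -
  have "al V u = al W u" if "u \<in> set xs \<union> set zs" for u
    using that cd_eq cd_distinct by (intro al_V_arc) auto
  then show ?thesis by (auto simp: cd_V cd_eq image_Un intro!: image_eqI)
qed

lemma set_cd_V: "set (cd V) = set (cd W) \<union> {z, y1}"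
  unfolding cd_V cd_eq by auto

lemma darts_V: "darts V = darts W \<union> {x1, x2, y1, y2, z, z'}"
  unfolding darts_def[of V] al_V_image unfolding set_cd_V wd_V darts_def[of W] by auto

lemma disk_V: "disk_map V"
proof -
  have D: "distinct (xs @ c # zs)" using cd_distinct cd_eq by simp
  have new: "{x1, x2, y1, y2, z, z'} \<inter> (wd W \<union> set (cd W) \<union> al W ` set (cd W)) = {}"
    using fresh(2) by (auto simp: darts_def)
  have "planar_map (darts V) (al V) (sg V)"
    unfolding darts_V using planar_map_attach[OF planar c_darts(1) fresh, of x2] by (auto simp: V_def)
  moreover have "distinct (cd V)"
    using D cd_darts fresh by (auto simp: cd_V cd_eq)
  moreover have "wd V \<inter> set (cd V) = {}" "wd V \<inter> al V ` set (cd V) = {}" "set (cd V) \<inter> al V ` set (cd V) = {}"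
  proof -
    define C where "C = set (cd W)"
    define E where "E = al W ` C"
    define N where "N = {x1, x2, y1, y2, z, z'}"
    have d: "wd W \<inter> C = {}" "wd W \<inter> E = {}" "C \<inter> E = {}" "N \<inter> (wd W \<union> C \<union> E) = {}"
      unfolding C_def E_def N_def using cd_wd al_cd_wd al_cd_cd new by blast+
    have p: "{x2, y2} \<inter> {z, y1} = {}" "{x2, y2} \<inter> {x1, z'} = {}" "{z, y1} \<inter> {x1, z'} = {}"
      "{x2, y2} \<subseteq> N" "{z, y1} \<subseteq> N" "{x1, z'} \<subseteq> N"
      using fresh_ne by (auto simp: N_def)
    have disj: "(A \<union> X) \<inter> (B \<union> Y) = {}"
      if "A \<inter> B = {}" "X \<inter> Y = {}" "X \<subseteq> N" "Y \<subseteq> N" "N \<inter> A = {}" "N \<inter> B = {}" for A B X Y :: "nat set"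
      using that by blast
    have N: "N \<inter> wd W = {}" "N \<inter> C = {}" "N \<inter> E = {}" using d(4) by blast+
    show "wd V \<inter> set (cd V) = {}"
      unfolding set_cd_V wd_V C_def[symmetric] by (rule disj) (fact d p N)+
    show "wd V \<inter> al V ` set (cd V) = {}"
      unfolding al_V_image wd_V C_def[symmetric] E_def[symmetric] by (rule disj) (fact d p N)+
    show "set (cd V) \<inter> al V ` set (cd V) = {}"
      unfolding al_V_image unfolding set_cd_V C_def[symmetric] E_def[symmetric] by (rule disj) (fact d p N)+
  qed
  moreover have "\<forall>d\<in>wd V. al V d \<in> wd V"
    by (auto simp: wd_V al_V_wd)
  moreover have hd: "hd (cd V) = hd (cd W)" unfolding cd_eq cd_V by (cases xs) auto
  moreover have last: "al V (last (cd V)) = al W (last (cd W))"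
  proof (cases "zs = []")
    case True
    moreover have "last (cd V) = (if zs = [] then y1 else last zs)" "last (cd W) = (if zs = [] then c else last zs)"
      by (simp_all add: cd_V cd_eq)
    ultimately show ?thesis using al_V(5) by metis
  next
    case False
    then have "last zs \<noteq> c" "last zs \<in> set (cd W)" using D by (auto simp: cd_eq)
    then show ?thesis using al_V_arc[of "last zs"] False by (simp add: cd_V cd_eq)
  qed
  moreover have "sg V (hd (cd W)) = al W (last (cd W))" "sg V (al W (last (cd W))) = hd (cd W)"
    using sg_hd sg_last cd_nonempty sg_V_old cd_darts by simp_all
  moreover have "\<forall>d\<in>darts V - {hd (cd W), al W (last (cd W))}. sg V d \<noteq> d \<and> sg V (sg V (sg V d)) = d"
    using triv fresh by (auto simp: darts_V sg_V_old)
  moreover have "successively (arc V) (cd V)"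
  proof -
    have old: "arc V u v" if "arc W u v" "u \<in> set (cd W)" "u \<noteq> c" "v \<in> set (cd W)" for u v
      using that al_V_arc[of u] by (auto simp: arc_def sg_V_old cd_darts wd_V wd_darts)
    have ch: "successively (arc W) (xs @ [c])" "successively (arc W) zs" "zs \<noteq> [] \<Longrightarrow> arc W c (hd zs)"
      using arcs unfolding cd_eq by (auto simp: successively_append_iff successively_Cons)
    have ch': "successively (arc W) xs" using ch(1) by (simp add: successively_append_iff)
    have "successively (arc V) xs" by (rule successively_mono[OF ch']) (rule old, use D cd_eq in auto)
    moreover have "successively (arc V) zs" by (rule successively_mono[OF ch(2)]) (rule old, use D cd_eq in auto)
    moreover have "xs \<noteq> [] \<Longrightarrow> arc V (last xs) c"
      using ch(1) D by (intro old) (auto simp: successively_append_iff cd_eq)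
    moreover have "arc V c z" "arc V z y1" by (auto simp: arc_def wd_V)
    moreover have "arc V y1 (hd zs)" if "zs \<noteq> []"
      using ch(3)[OF that] that by (auto simp: arc_def sg_V_old c_darts wd_V cd_darts cd_eq)
    ultimately show ?thesis by (auto simp: cd_V successively_append_iff successively_Cons)
  qed
  ultimately show ?thesis unfolding disk_map_def by (simp add: cd_V)
qed

definition \<delta>V :: "(nat \<Rightarrow> weight) \<Rightarrow> weight \<Rightarrow> nat \<Rightarrow> weight" where
  "\<delta>V \<delta> p d = (if d = z \<or> d = y2 then p else if d = x2 \<or> d = y1 then \<delta> c else \<delta> d)"

lemma inner_V: "inner V = inner W \<union> {x2, y2, z, y1}"
  unfolding inner_def set_cd_V wd_V by auto

lemma \<delta>V_inner: "d \<in> inner W \<Longrightarrow> \<delta>V \<delta> p d = \<delta> d"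
  using new_ne[of d] by (auto simp: \<delta>V_def inner_def darts_def)

lemma \<delta>V_new: "\<delta>V \<delta> p z = p" "\<delta>V \<delta> p y2 = p" "\<delta>V \<delta> p x2 = \<delta> c" "\<delta>V \<delta> p y1 = \<delta> c"
  using fresh_ne by (auto simp: \<delta>V_def)

lemma phi_V: "phi V c = x2" "phi V x2 = y1" "phi V y1 = phi W c" "phi V z = y2" "phi V y2 = z"
  "d \<in> inner W \<Longrightarrow> d \<noteq> c \<Longrightarrow> phi V d = phi W d"
proof -
  show "phi V c = x2" "phi V x2 = y1" "phi V y1 = phi W c" "phi V z = y2" "phi V y2 = z"
    using c_darts by (simp_all add: phi_def sg_V_old)
  assume d: "d \<in> inner W" "d \<noteq> c"
  then have "d \<noteq> al W c" "d \<in> darts W"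
    using al_cd_cd al_cd_wd c_arc(1) by (auto simp: inner_def darts_def)
  then show "phi V d = phi W d" using d by (simp add: phi_def sg_V_old al_V_old)
qed

lemma potential_V:
  assumes pot: "potential n W \<delta>" and fund: "fund_step n (\<delta> c) p"
  shows "potential n V (\<delta>V \<delta> p)"
proof -
  let ?\<delta> = "\<delta>V \<delta> p"
  have cei: "c \<in> inner W" "phi W c \<in> inner W" using c_arc inner_phi by (auto simp: inner_def)
  have inV: "inner W \<subseteq> inner V" "{x2, y2, z, y1} \<subseteq> inner V"
    by (auto simp: inner_V)
  have wdV: "wd W \<subseteq> wd V" by (auto simp: wd_V)
  have const: "?\<delta> (phi V d) = ?\<delta> d" if d: "d \<in> inner V" for d
  proof -
    consider "d = c" | "d = x2" | "d = y1" | "d = z" | "d = y2" | "d \<in> inner W" "d \<noteq> c"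
      using d unfolding inner_V by auto
    then show ?thesis
      by cases (use cei pot in \<open>auto simp: phi_V \<delta>V_new \<delta>V_inner inner_phi potential_def\<close>)
  qed
  have reach_new: "reach n V ?\<delta> x2" "reach n V ?\<delta> y1" "reach n V ?\<delta> (phi W c)" if "reach n V ?\<delta> c"
  proof -
    show 1: "reach n V ?\<delta> x2" using reach_phi[OF that] cei inV by (auto simp: phi_V)
    show 2: "reach n V ?\<delta> y1" using reach_phi[OF 1] inV by (auto simp: phi_V)
    show "reach n V ?\<delta> (phi W c)" using reach_phi[OF 2] inV by (auto simp: phi_V)
  qed
  have reach_old: "reach n V ?\<delta> d \<and> d \<in> inner W" if "reach n W \<delta> d" for d
    using that
  proof (induction rule: reach.induct)
    case reach_hd
    have "hd (cd V) = hd (cd W)" unfolding cd_eq cd_V by (cases xs) auto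
    then show ?case using cd_nonempty reach.reach_hd[of n V ?\<delta>] by (simp add: inner_def)
  next
    case (reach_phi d)
    have "reach n V ?\<delta> (phi W d)" if "d \<noteq> c"
      using that reach.reach_phi[of n V ?\<delta> d] phi_V(6)[of d] reach_phi inV by auto
    then show ?case using reach_phi inner_phi reach_new(3) by (cases "d = c") auto
  next
    case (reach_al d)
    then have "d \<in> inner W" "al W d \<in> inner W" by (auto simp: inner_def)
    then show ?case
      using reach_al reach.reach_al[of n V ?\<delta> d] wdV al_V_wd[of d] by (auto simp: \<delta>V_inner)
  qed
  have cnew: "coreach n V ?\<delta> z" "coreach n V ?\<delta> y1" "coreach n V ?\<delta> x2" "coreach n V ?\<delta> y2"
  proof -
    show 1: "coreach n V ?\<delta> z" "coreach n V ?\<delta> y1" by (auto intro: coreach_cd simp: cd_V)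
    show "coreach n V ?\<delta> x2" using coreach_phi[of n V ?\<delta> x2] 1 inV by (auto simp: phi_V)
    show "coreach n V ?\<delta> y2" using coreach_phi[of n V ?\<delta> y2] 1 inV by (auto simp: phi_V)
  qed
  have coreach_old: "coreach n V ?\<delta> d" if "coreach n W \<delta> d" for d
    using that
  proof (induction rule: coreach.induct)
    case (coreach_cd d)
    then show ?case using set_cd_V by (auto intro: coreach.coreach_cd)
  next
    case (coreach_phi d)
    have "coreach n V ?\<delta> (phi V d)"
      using phi_V(1) phi_V(6)[of d] coreach_phi cnew by (cases "d = c") auto
    then show ?case using coreach_phi inV by (auto intro: coreach.coreach_phi)
  next
    case (coreach_al d)
    then have "d \<in> inner W" "al W d \<in> inner W" by (auto simp: inner_def)
    then show ?case
      using coreach_al coreach.coreach_al[of n V ?\<delta> d] wdV al_V_wd[of d] by (auto simp: \<delta>V_inner)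
  qed
  have allW: "reach n V ?\<delta> d \<and> coreach n V ?\<delta> d" if "d \<in> inner W" for d
    using that pot reach_old coreach_old by (auto simp: potential_def)
  have rnew: "reach n V ?\<delta> x2" "reach n V ?\<delta> y1" using reach_new allW cei by auto
  have ry: "reach n V ?\<delta> y2"
    using reach_al[of n V ?\<delta> x2] rnew fund by (auto simp: wd_V \<delta>V_new)
  have rz: "reach n V ?\<delta> z" using reach_phi[OF ry] inV by (auto simp: phi_V)
  have steps: "minuscule_step n (?\<delta> d) (?\<delta> (al V d))" if d: "d \<in> wd V" for d
  proof (cases "d \<in> wd W")
    case True
    then have "d \<in> inner W" "al W d \<in> inner W" by (auto simp: inner_def)
    then show ?thesis using True pot by (simp add: \<delta>V_inner al_V_wd potential_def)
  next
    case False
    then have "d = x2 \<or> d = y2" using d by (simp add: wd_V)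
    then show ?thesis using fund_imp_minuscule[OF fund] minuscule_step_sym by (auto simp: \<delta>V_new)
  qed
  show ?thesis unfolding potential_def
    using const steps allW rnew ry rz cnew by (auto simp: inner_V)
qed

end

section \<open>Boundary paths of webs with a potential\<close>

lemma wt_eq_add: "wt_eq n x y \<Longrightarrow> wt_eq n (\<lambda>i. x i + v i) (\<lambda>i. y i + v i)"
  unfolding wt_eq_def by (auto simp: algebra_simps)

lemma minuscule_step_cong:
  assumes "minuscule_step n x y" "wt_eq n x x'" "wt_eq n y y'" shows "minuscule_step n x' y'"
proof -
  obtain S where "S \<subseteq> {1..n}" "S \<noteq> {}" "S \<noteq> {1..n}" "wt_eq n y (\<lambda>i. x i + ind S i)"
    using assms(1) unfolding minuscule_step_def by blast
  moreover from this have "wt_eq n y' (\<lambda>i. x' i + ind S i)"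
    using assms(2,3) wt_eq_add wt_eq_sym wt_eq_trans by meson
  ultimately show ?thesis unfolding minuscule_step_def by blast
qed

lemma fund_step_cong:
  assumes "fund_step n x y" "wt_eq n x x'" "wt_eq n y y'" shows "fund_step n x' y'"
proof -
  obtain b where "b \<in> {1..<n}" "wt_eq n y (\<lambda>i. x i + ind {1..b} i)"
    using assms(1) unfolding fund_step_def by blast
  moreover from this have "wt_eq n y' (\<lambda>i. x' i + ind {1..b} i)"
    using assms(2,3) wt_eq_add wt_eq_sym wt_eq_trans by meson
  ultimately show ?thesis unfolding fund_step_def by blast
qed

lemma dominant_cong:
  assumes "dominant n x" "wt_eq n x y" shows "dominant n y"
proof -
  obtain c where c: "\<forall>i\<in>{1..n}. x i = y i + c" using assms(2) by (auto simp: wt_eq_def)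
  have "y (Suc i) \<le> y i" if "1 \<le> i" "i < n" for i
  proof -
    have "x (Suc i) \<le> x i" using assms(1) that by (auto simp: dominant_def)
    moreover have "x (Suc i) = y (Suc i) + c" "x i = y i + c" using c that by auto
    ultimately show ?thesis by simp
  qed
  then show ?thesis by (auto simp: dominant_def)
qed

definition realizable :: "nat \<Rightarrow> weight list \<Rightarrow> bool" where
  "realizable n F \<longleftrightarrow> (\<exists>W \<delta>. disk_map W \<and> potential n W \<delta> \<and>
     list_all2 (\<lambda>d f. wt_eq n (\<delta> d) f) (cd W) F \<and> wt_eq n (\<delta> (hd (cd W))) wt_zero)"

lemma realizable_cong:
  assumes "realizable n F" "list_all2 (wt_eq n) F F'" shows "realizable n F'"
proof -
  obtain W \<delta> where W: "disk_map W" "potential n W \<delta>" "wt_eq n (\<delta> (hd (cd W))) wt_zero"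
    "list_all2 (\<lambda>d f. wt_eq n (\<delta> d) f) (cd W) F"
    using assms(1) unfolding realizable_def by blast
  have "list_all2 (\<lambda>d f. wt_eq n (\<delta> d) f) (cd W) F'"
    by (rule list_all2_trans[OF _ W(4) assms(2)]) (rule wt_eq_trans)
  then show ?thesis using W unfolding realizable_def by blast
qed

lemma realizable_cong_append:
  assumes "realizable n (F @ G)" "list_all2 (wt_eq n) G G'" shows "realizable n (F @ G')"
  by (rule realizable_cong[OF assms(1)]) (use assms(2) in \<open>auto intro!: list_all2_appendI list.rel_refl\<close>)

lemma fresh_darts:
  assumes "finite (H :: nat set)"
  obtains x1 x2 y1 y2 z z' where "distinct [x1, x2, y1, y2, z, z']" "set [x1, x2, y1, y2, z, z'] \<inter> H = {}"
proof -
  obtain N where "\<forall>d\<in>H. d < N" using assms finite_nat_set_iff_bounded by auto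
  then show ?thesis using that[of N "N+1" "N+2" "N+3" "N+4" "N+5"] by fastforce
qed

lemma list_all2_memD: "list_all2 R us vs \<Longrightarrow> u \<in> set us \<Longrightarrow> \<exists>v\<in>set vs. R u v"
  by (induction rule: list_all2_induct) auto

lemma successively_list_all2:
  assumes "list_all2 R us vs" "successively P vs"
    "\<And>u u' v v'. R u v \<Longrightarrow> R u' v' \<Longrightarrow> P v v' \<Longrightarrow> Q u u'"
  shows "successively Q us"
  using assms(1,2)
proof (induction rule: list_all2_induct)
  case (Cons u us v vs)
  have "R (hd us) (hd vs)" if "us \<noteq> []" using Cons(2) that by (cases us; cases vs) auto
  then show ?case using Cons assms(3) by (auto simp: successively_Cons)
qed simp

lemma realizable_cone:
  assumes real: "realizable n (fs @ f # gs @ g # hs)" and fund: "fund_step n f p"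
    and adj: "\<forall>u\<in>set (f # gs @ [g]). minuscule_step n u p"
    and up: "successively (fund_step n) (gs @ [g])"
  shows "realizable n (fs @ f # p # g # hs)"
proof -
  obtain W \<delta> where W: "disk_map W" "potential n W \<delta>" "wt_eq n (\<delta> (hd (cd W))) wt_zero"
    "list_all2 (\<lambda>d f. wt_eq n (\<delta> d) f) (cd W) (fs @ f # gs @ g # hs)"
    using real unfolding realizable_def by blast
  obtain xs c ms e zs where cd: "cd W = xs @ c # ms @ e # zs"
    and l: "list_all2 (\<lambda>d f. wt_eq n (\<delta> d) f) xs fs" "wt_eq n (\<delta> c) f"
     "list_all2 (\<lambda>d f. wt_eq n (\<delta> d) f) ms gs" "wt_eq n (\<delta> e) g" "list_all2 (\<lambda>d f. wt_eq n (\<delta> d) f) zs hs"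
    using W(4) by (auto simp: list_all2_append2 list_all2_Cons2)
  obtain x1 x2 y1 y2 z z' where fresh: "distinct [x1, x2, y1, y2, z, z']" "set [x1, x2, y1, y2, z, z'] \<inter> darts W = {}"
    by (rule fresh_darts[OF disk.finite_darts[OF disk.intro[OF W(1)]]])
  interpret cone W xs ms zs c e x1 x2 y1 y2 z z'
    by unfold_locales (fact W(1), fact cd, fact fresh(1), fact fresh(2))
  have le: "list_all2 (\<lambda>d f. wt_eq n (\<delta> d) f) (ms @ [e]) (gs @ [g])"
    using l by (auto intro: list_all2_appendI)
  have lc: "list_all2 (\<lambda>d f. wt_eq n (\<delta> d) f) (c # ms @ [e]) (f # gs @ [g])"
    using l le by auto
  have "potential n V (\<delta>V \<delta> p)"
  proof (rule potential_V[OF W(2)])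
    show "fund_step n (\<delta> c) p" by (rule fund_step_cong[OF fund wt_eq_sym[OF l(2)]]) simp
    show "\<forall>u\<in>set (c # ms @ [e]). minuscule_step n (\<delta> u) p"
    proof
      fix u assume "u \<in> set (c # ms @ [e])"
      then obtain v where v: "v \<in> set (f # gs @ [g])" "wt_eq n (\<delta> u) v"
        using list_all2_memD[OF lc] by blast
      have "minuscule_step n v p" using adj v(1) by blast
      then show "minuscule_step n (\<delta> u) p" by (rule minuscule_step_cong[OF _ wt_eq_sym[OF v(2)] wt_eq_refl])
    qed
    show "successively (\<lambda>u v. fund_step n (\<delta> u) (\<delta> v)) (ms @ [e])"
      by (rule successively_list_all2[OF le up]) (rule fund_step_cong[OF _ wt_eq_sym wt_eq_sym])
  qed
  moreover have "hd (cd V) = hd (cd W)" unfolding cd_V cd by (cases xs) auto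
  moreover have same: "\<delta>V \<delta> p u = \<delta> u" if "u \<in> set (cd W)" for u using that by (intro \<delta>V_inner) (auto simp: inner_def)
  moreover have "list_all2 (\<lambda>d f. wt_eq n (\<delta>V \<delta> p d) f) (cd V) (fs @ f # p # g # hs)"
  proof -
    have tr: "list_all2 (\<lambda>d f. wt_eq n (\<delta>V \<delta> p d) f) us F"
      if "list_all2 (\<lambda>d f. wt_eq n (\<delta> d) f) us F" "set us \<subseteq> set (cd W)" for us F
      using that(2) by (intro list.rel_mono_strong[OF that(1)]) (auto simp: same)
    have "list_all2 (\<lambda>d f. wt_eq n (\<delta>V \<delta> p d) f) xs fs" "list_all2 (\<lambda>d f. wt_eq n (\<delta>V \<delta> p d) f) zs hs"
      using l(1,5) by (auto simp: cd intro: tr)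
    then show ?thesis unfolding cd_V using l same[of c] by (simp add: list_all2_appendI \<delta>V_new cd)
  qed
  ultimately show ?thesis using disk_V W(3) cd_nonempty unfolding realizable_def
    by (intro exI[of _ V] exI[of _ "\<delta>V \<delta> p"]) auto
qed

lemma realizable_cap:
  assumes real: "realizable n (fs @ f # hs)" and fund: "fund_step n f p"
  shows "realizable n (fs @ f # p # f # hs)"
proof -
  obtain W \<delta> where W: "disk_map W" "potential n W \<delta>" "wt_eq n (\<delta> (hd (cd W))) wt_zero"
    "list_all2 (\<lambda>d f. wt_eq n (\<delta> d) f) (cd W) (fs @ f # hs)"
    using real unfolding realizable_def by blast
  obtain xs c zs where cd: "cd W = xs @ c # zs"
    and l: "list_all2 (\<lambda>d f. wt_eq n (\<delta> d) f) xs fs" "wt_eq n (\<delta> c) f" "list_all2 (\<lambda>d f. wt_eq n (\<delta> d) f) zs hs"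
    using W(4) by (auto simp: list_all2_append2 list_all2_Cons2)
  obtain x1 x2 y1 y2 z z' where fresh: "distinct [x1, x2, y1, y2, z, z']" "set [x1, x2, y1, y2, z, z'] \<inter> darts W = {}"
    by (rule fresh_darts[OF disk.finite_darts[OF disk.intro[OF W(1)]]])
  interpret cap W xs zs c x1 x2 y1 y2 z z'
    by unfold_locales (fact W(1), fact cd, fact fresh(1), fact fresh(2))
  have "potential n V (\<delta>V \<delta> p)"
    by (rule potential_V[OF W(2)]) (rule fund_step_cong[OF fund wt_eq_sym[OF l(2)]], simp)
  moreover have "hd (cd V) = hd (cd W)" unfolding cd_V cd by (cases xs) auto
  moreover have same: "\<delta>V \<delta> p u = \<delta> u" if "u \<in> set (cd W)" for u using that by (intro \<delta>V_inner) (auto simp: inner_def)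
  moreover have "list_all2 (\<lambda>d f. wt_eq n (\<delta>V \<delta> p d) f) (cd V) (fs @ f # p # f # hs)"
  proof -
    have tr: "list_all2 (\<lambda>d f. wt_eq n (\<delta>V \<delta> p d) f) us F"
      if "list_all2 (\<lambda>d f. wt_eq n (\<delta> d) f) us F" "set us \<subseteq> set (cd W)" for us F
      using that(2) by (intro list.rel_mono_strong[OF that(1)]) (auto simp: same)
    have "list_all2 (\<lambda>d f. wt_eq n (\<delta>V \<delta> p d) f) xs fs" "list_all2 (\<lambda>d f. wt_eq n (\<delta>V \<delta> p d) f) zs hs"
      using l(1,3) by (auto simp: cd intro: tr)
    then show ?thesis unfolding cd_V using l same[of c] by (simp add: list_all2_appendI \<delta>V_new cd)
  qed
  ultimately show ?thesis using disk_V W(3) cd_nonempty unfolding realizable_def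
    by (intro exI[of _ V] exI[of _ "\<delta>V \<delta> p"]) auto
qed

lemma realizable_zero: "realizable n [wt_zero]"
proof -
  define t where "t = transpose (0::nat) 1"
  define W where "W = \<lparr>wd = {}, cd = [0], al = t, sg = t, lab = \<lambda>_. 0\<rparr>"
  have d: "darts W = {0, 1}" by (auto simp: W_def darts_def t_def)
  have t: "t 0 = 1" "t (Suc 0) = 0" "t \<circ> t = id" "t (t d) = d" "t permutes {0, 1}" for d
    by (auto simp: t_def permutes_swap_id)
  have o: "orb t 0 = {0, 1}" "orb t (Suc 0) = {0, 1}"
  proof -
    have "orb t 0 \<subseteq> {0, 1}" by (rule orb_least) (auto simp: t)
    moreover have "orb t (Suc 0) \<subseteq> {0, 1}" by (rule orb_least) (auto simp: t)
    moreover have "t 0 \<in> orb t 0" "t (Suc 0) \<in> orb t (Suc 0)" by (auto intro: orb_step)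
    ultimately show "orb t 0 = {0, 1}" "orb t (Suc 0) = {0, 1}" using orb_self[of 0 t] orb_self[of "Suc 0" t] by (auto simp: t)
  qed
  have i: "orb id u = {u}" for u :: nat 
  proof -
    have "orb id u \<subseteq> {u}" by (rule orb_least) auto
    then show ?thesis using orb_self by fastforce
  qed
  have "(u, v) \<in> (links {0, 1} t t)\<^sup>*" if "u \<in> {0, 1}" "v \<in> {0, 1}" for u v
  proof -
    have "(0, 1) \<in> links {0, 1} t t" "(1, 0) \<in> links {0, 1} t t" using t by (auto simp: links_def)
    then show ?thesis using that by auto
  qed
  then have "planar_map {0, 1} t t"
    unfolding planar_map_def using t by (auto simp: orbits_image o i)
  then have "disk_map W" unfolding disk_map_def d by (auto simp: W_def t)
  moreover have "potential n W (\<lambda>_. wt_zero)"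
    unfolding potential_def inner_def 
    using reach_hd[of n W "\<lambda>_. wt_zero"] coreach_cd[of 0 W n "\<lambda>_. wt_zero"] by (auto simp: W_def)
  ultimately show ?thesis unfolding realizable_def
    by (intro exI[of _ W] exI[of _ "\<lambda>_. wt_zero"]) (auto simp: W_def)
qed

fun tot :: "weight \<Rightarrow> nat list \<Rightarrow> weight" where
  "tot u [] = u"
| "tot u (b # bs) = tot (\<lambda>i. u i + ind {1..b} i) bs"

fun steps :: "weight \<Rightarrow> nat list \<Rightarrow> weight list" where
  "steps u [] = []"
| "steps u (b # bs) = u # steps (\<lambda>i. u i + ind {1..b} i) bs"

lemma tot_append: "tot u (as @ bs) = tot (tot u as) bs"
  by (induction as arbitrary: u) auto

lemma steps_append: "steps u (as @ bs) = steps u as @ steps (tot u as) bs"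
  by (induction as arbitrary: u) auto

lemma tot_apply: "tot u bs i = u i + (\<Sum>b\<leftarrow>bs. ind {1..b} i)"
  by (induction bs arbitrary: u) auto

lemma steps_cong: "wt_eq n u v \<Longrightarrow> list_all2 (wt_eq n) (steps u bs) (steps v bs)"
  by (induction bs arbitrary: u v) (auto intro: wt_eq_add)

lemma tot_cong: "wt_eq n u v \<Longrightarrow> wt_eq n (tot u bs) (tot v bs)"
  by (induction bs arbitrary: u v) (auto intro: wt_eq_add)

lemma steps_hd: obtains t where "steps u bs @ tot u bs # zs = u # t"
  by (cases bs) auto

lemma fund_stepI: "b \<in> {1..<n} \<Longrightarrow> fund_step n x (\<lambda>i. x i + ind {1..b} i)"
  unfolding fund_step_def by (blast intro: wt_eq_refl)

lemma realizable_swap: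
  assumes b: "b \<in> {1..<n}" and x: "x \<in> {1..<n}"
    and real: "realizable n (steps wt_zero (as @ b # x # cs) @ tot wt_zero (as @ b # x # cs) # zs)"
  shows "realizable n (steps wt_zero (as @ x # b # cs) @ tot wt_zero (as @ x # b # cs) # zs)"
proof (cases "x = b")
  case True
  then show ?thesis using real by simp
next
  case False
  define u where "u = tot wt_zero as"
  define q p v where "q = (\<lambda>i. u i + ind {1..b} i)" and "p = (\<lambda>i. u i + ind {1..x} i)"
    and "v = (\<lambda>i. u i + ind {1..b} i + ind {1..x} i)"
  have v: "v = (\<lambda>i. p i + ind {1..b} i)" "v = (\<lambda>i. q i + ind {1..x} i)"
    by (auto simp: v_def p_def q_def)
  obtain t where t: "steps v cs @ tot v cs # zs = v # t" by (rule steps_hd)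
  have "realizable n (steps wt_zero as @ u # [q] @ v # t)"
    using real unfolding t[symmetric] by (simp add: steps_append tot_append u_def q_def v_def)
  moreover have fund: "fund_step n u p" "fund_step n q v" "fund_step n p v"
    unfolding p_def q_def using fund_stepI[OF x, of u] fund_stepI[OF x, of q] fund_stepI[OF b, of p] v
    by (simp_all add: p_def q_def)
  moreover have "minuscule_step n q p"
  proof (cases "x < b")
    case True
    have "minuscule_step n p q" unfolding minuscule_step_def
    proof (intro exI[of _ "{x<..b}"] conjI)
      have "x \<notin> {x<..b}" "x \<in> {1..n}" using x by auto
      then show "{x<..b} \<noteq> {1..n}" by blast
      have "q = (\<lambda>i. p i + ind {x<..b} i)" using True by (auto simp: p_def q_def ind_def fun_eq_iff)
      then show "wt_eq n q (\<lambda>i. p i + ind {x<..b} i)" by simp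
    qed (use True b x in auto)
    then show ?thesis by (rule minuscule_step_sym)
  next
    case f: False
    show ?thesis unfolding minuscule_step_def
    proof (intro exI[of _ "{b<..x}"] conjI)
      have "b \<notin> {b<..x}" "b \<in> {1..n}" using b by auto
      then show "{b<..x} \<noteq> {1..n}" by blast
      have "p = (\<lambda>i. q i + ind {b<..x} i)" using f False by (auto simp: p_def q_def ind_def fun_eq_iff)
      then show "wt_eq n p (\<lambda>i. q i + ind {b<..x} i)" by simp
    qed (use False f b x in auto)
  qed
  ultimately have "realizable n (steps wt_zero as @ u # p # v # t)"
    by (intro realizable_cone[where gs = "[q]"]) (auto intro: fund_imp_minuscule minuscule_step_sym)
  then show ?thesis
    unfolding t[symmetric] by (simp add: steps_append tot_append u_def p_def v_def add.commute add.left_commute)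
qed

lemma realizable_move:
  assumes "set cs \<subseteq> {1..<n}" and x: "x \<in> {1..<n}"
    and "realizable n (steps wt_zero (as @ cs @ [x]) @ tot wt_zero (as @ cs @ [x]) # zs)"
  shows "realizable n (steps wt_zero (as @ x # cs) @ tot wt_zero (as @ x # cs) # zs)"
  using assms(1,3)
proof (induction cs arbitrary: as)
  case (Cons c cs)
  have "realizable n (steps wt_zero ((as @ [c]) @ x # cs) @ tot wt_zero ((as @ [c]) @ x # cs) # zs)"
    by (rule Cons.IH) (use Cons.prems in auto)
  then have "realizable n (steps wt_zero (as @ c # x # cs) @ tot wt_zero (as @ c # x # cs) # zs)" by simp
  from realizable_swap[OF _ x this] show ?case using Cons.prems(1) by simp
qed simp

lemma tot_eq_Suc: "x \<notin> set bs \<Longrightarrow> x \<ge> 1 \<Longrightarrow> tot wt_zero bs (Suc x) = tot wt_zero bs x"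
  by (induction bs) (auto simp: tot_apply wt_zero_def ind_def)

lemma tot_Suc_le: "tot wt_zero bs (Suc x) \<le> tot wt_zero bs x" if "x \<ge> 1"
  using that by (induction bs) (auto simp: tot_apply wt_zero_def ind_def)

lemma tot_move: "tot u (as @ x # cs) = (\<lambda>i. tot u (as @ cs) i + ind {1..x} i)"
  by (auto simp: tot_apply fun_eq_iff)

text \<open>The first step of the boundary path that is not fundamental is \<open>S\<close>; let \<open>{x<..t}\<close> be its last run.
Dominance forces a fundamental step \<open>x\<close> before it, which can be moved next to \<open>S\<close>.  Since
\<open>ind {1..x} + ind S = ind (S \<inter> {1..x}) + ind {1..t}\<close>, the step \<open>S\<close> can be replaced by the shorter step
\<open>S \<inter> {1..x}\<close> one place earlier; the cases \<open>t = n\<close> and \<open>S \<inter> {1..x} = {}\<close> degenerate to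
merging or capping strands.\<close>

lemma realizable_strip:
  assumes "set bs \<subseteq> {1..<n}" "set cs \<subseteq> {1..<n}" "S \<subseteq> {1..n}" "S \<noteq> {}" "S \<noteq> {1..n}"
    "\<nu> = (\<lambda>i. tot wt_zero bs i + ind S i)" "dominant n \<nu>"
    "\<And>ds. set ds \<subseteq> {1..<n} \<Longrightarrow> wt_eq n (tot wt_zero ds) (tot \<nu> cs) \<Longrightarrow>
      realizable n (steps wt_zero ds @ tot wt_zero ds # zs)"
  shows "realizable n (steps wt_zero bs @ tot wt_zero bs # steps \<nu> cs @ tot \<nu> cs # zs)"
  using assms
proof (induction "length bs" arbitrary: bs S cs \<nu> rule: less_induct)
  case less
  note bs = less.prems(1) and cs = less.prems(2) and S = less.prems(3-5) and \<nu> = less.prems(6)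
    and dom = less.prems(7) and base = less.prems(8)
  let ?o = "wt_zero"
  define t where "t = Max S"
  have finS: "finite S" using S(1) finite_subset by blast
  have t: "t \<in> S" "\<And>i. i \<in> S \<Longrightarrow> i \<le> t" using finS S(2) by (auto simp: t_def)
  have tn: "1 \<le> t" "t \<le> n" using t(1) S(1) by auto
  show ?case
  proof (cases "S = {1..t}")
    case True
    then have "t < n" using S(3) tn by (cases "t = n") auto
    have "realizable n (steps ?o (bs @ t # cs) @ tot ?o (bs @ t # cs) # zs)"
      by (rule base) (use bs cs tn \<open>t < n\<close> True \<nu> in \<open>auto simp: tot_append\<close>)
    then show ?thesis using True \<nu> by (simp add: steps_append tot_append)
  next
    case False
    define x where "x = Max ({1..t} - S)"
    have "S \<subseteq> {1..t}" using S(1) t(2) by auto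
    then have "{1..t} - S \<noteq> {}" using False by auto
    then have "x \<in> {1..t} - S" unfolding x_def by (intro Max_in) auto
    then have x: "1 \<le> x" "x < t" "x \<notin> S" using t(1) by (auto simp: le_less)
    have run: "i \<in> S" if "x < i" "i \<le> t" for i
      using that x(1) Max_ge[of "{1..t} - S" i] unfolding x_def[symmetric] by force
    have "x \<in> set bs"
    proof (rule ccontr)
      assume "x \<notin> set bs"
      then have "tot ?o bs (Suc x) = tot ?o bs x" using x(1) by (rule tot_eq_Suc)
      then have "\<nu> x < \<nu> (Suc x)" using run[of "Suc x"] x by (simp add: \<nu> ind_def)
      then show False using dom x tn by (auto simp: dominant_def not_le[symmetric])
    qed
    then obtain as cs' where split: "bs = as @ x # cs'" by (auto dest: split_list)
    define bs1 where "bs1 = as @ cs'"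
    have bs1: "set bs1 \<subseteq> {1..<n}" "length bs1 < length bs" "x \<in> {1..<n}" "set cs' \<subseteq> {1..<n}"
      using bs by (auto simp: bs1_def split)
    define u p where "u = tot ?o bs1" and "p = tot ?o bs"
    have p: "p = (\<lambda>i. u i + ind {1..x} i)" unfolding p_def u_def split bs1_def by (rule tot_move)
    have \<nu>p: "\<nu> = (\<lambda>i. p i + ind S i)" using \<nu> by (simp add: p_def)
    define T where "T = S \<inter> {1..x}"
    define q where "q = (\<lambda>i. u i + ind T i)"
    have \<nu>q: "\<nu> = (\<lambda>i. q i + ind {1..t} i)"
    proof
      fix i
      have "i \<in> S \<Longrightarrow> i \<le> t \<and> 1 \<le> i" using t(2) S(1) by auto
      then show "\<nu> i = q i + ind {1..t} i"
        using run[of i] x by (auto simp: \<nu>p p q_def T_def ind_def)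
    qed
    obtain R where R: "steps \<nu> cs @ tot \<nu> cs # zs = \<nu> # R" by (rule steps_hd)
    have fund: "fund_step n u p" using bs1(3) p unfolding fund_step_def by (intro bexI[of _ x]) auto
    have min_up: "minuscule_step n u p" using fund by (rule fund_imp_minuscule)
    have min_\<nu>p: "minuscule_step n \<nu> p"
      by (rule minuscule_step_sym) (use S \<nu>p in \<open>auto simp: minuscule_step_def intro!: exI[of _ S]\<close>)
    have T: "T \<subseteq> {1..n}" "T \<noteq> {1..n}" "x \<notin> T" using S(1) x tn by (auto simp: T_def)
    have domq: "dominant n q"
    proof -
      have "q (Suc i) \<le> q i" if i: "1 \<le> i" "i < n" for i
      proof (cases "i = t")
        case True
        then show ?thesis using tot_Suc_le[OF i(1), of bs1] x by (simp add: q_def T_def ind_def u_def)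
      next
        case False
        then have "ind {1..t} (Suc i) = ind {1..t} i" using i by (auto simp: ind_def)
        moreover have "\<nu> (Suc i) \<le> \<nu> i" using dom i by (auto simp: dominant_def)
        ultimately show ?thesis by (simp add: \<nu>q)
      qed
      then show ?thesis by (auto simp: dominant_def)
    qed
    have min_qp: "minuscule_step n q p" unfolding minuscule_step_def
    proof (intro exI[of _ "{1..x} - T"] conjI)
      show "{1..x} - T \<noteq> {}" using x T by auto
      show "{1..x} - T \<subseteq> {1..n}" using x tn by auto
      have "t \<in> {1..n}" "t \<notin> {1..x} - T" using x tn by auto
      then show "{1..x} - T \<noteq> {1..n}" by blast
      have "p = (\<lambda>i. q i + ind ({1..x} - T) i)" by (auto simp: p q_def T_def ind_def fun_eq_iff)
      then show "wt_eq n p (\<lambda>i. q i + ind ({1..x} - T) i)" by simp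
    qed
    have top: "wt_eq n \<nu> q" if "t = n"
      unfolding wt_eq_def \<nu>q using that by (intro exI[of _ 1]) (auto simp: ind_def)
    have goal: "realizable n (steps ?o bs1 @ u # p # \<nu> # R)"
    proof (cases "t < n"; cases "T = {}")
      assume tn': "t < n" and "T \<noteq> {}"
      have "realizable n (steps ?o bs1 @ tot ?o bs1 # steps q (t # cs) @ tot q (t # cs) # zs)"
      proof (rule less.hyps[OF bs1(2,1) _ T(1) \<open>T \<noteq> {}\<close> T(2) _ domq])
        show "set (t # cs) \<subseteq> {1..<n}" using cs tn tn' by auto
        show "q = (\<lambda>i. tot wt_zero bs1 i + ind T i)" by (simp add: q_def u_def)
        show "realizable n (steps ?o ds @ tot ?o ds # zs)"
          if "set ds \<subseteq> {1..<n}" "wt_eq n (tot ?o ds) (tot q (t # cs))" for ds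
          using base[OF that(1)] that(2) by (simp add: \<nu>q)
      qed
      then have "realizable n (steps ?o bs1 @ u # [q] @ \<nu> # R)"
        unfolding R[symmetric] by (simp add: \<nu>q u_def)
      moreover have "fund_step n q \<nu>" using tn tn' \<nu>q unfolding fund_step_def by (intro bexI[of _ t]) auto
      ultimately show ?thesis
        using fund min_up min_\<nu>p min_qp by (intro realizable_cone[where gs = "[q]"]) auto
    next
      assume tn': "t < n" and T0: "T = {}"
      have \<nu>u: "\<nu> = (\<lambda>i. u i + ind {1..t} i)" using T0 by (simp add: \<nu>q q_def ind_def)
      have "realizable n (steps ?o (bs1 @ t # cs) @ tot ?o (bs1 @ t # cs) # zs)"
        by (rule base) (use bs1 cs tn tn' in \<open>auto simp: tot_append \<nu>u u_def\<close>)
      then have "realizable n (steps ?o bs1 @ u # [] @ \<nu> # R)"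
        unfolding append_Nil R[symmetric] by (simp add: steps_append tot_append \<nu>u u_def)
      then show ?thesis using fund min_up min_\<nu>p by (intro realizable_cone[where gs = "[]"]) auto
    next
      assume "\<not> t < n" and "T \<noteq> {}"
      then have \<nu>q': "wt_eq n \<nu> q" using top tn by auto
      have "realizable n (steps ?o bs1 @ tot ?o bs1 # steps q cs @ tot q cs # zs)"
      proof (rule less.hyps[OF bs1(2,1) cs T(1) \<open>T \<noteq> {}\<close> T(2) _ domq])
        show "q = (\<lambda>i. tot wt_zero bs1 i + ind T i)" by (simp add: q_def u_def)
        show "realizable n (steps ?o ds @ tot ?o ds # zs)"
          if "set ds \<subseteq> {1..<n}" "wt_eq n (tot ?o ds) (tot q cs)" for ds
          using base[OF that(1)] that(2) tot_cong[OF \<nu>q'] wt_eq_sym wt_eq_trans by blast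
      qed
      then have "realizable n ((steps ?o bs1 @ [u]) @ (steps q cs @ tot q cs # zs))" by (simp add: u_def)
      then have "realizable n ((steps ?o bs1 @ [u]) @ (steps \<nu> cs @ tot \<nu> cs # zs))"
        by (rule realizable_cong_append)
          (use steps_cong[OF wt_eq_sym[OF \<nu>q']] tot_cong[OF wt_eq_sym[OF \<nu>q']] in
            \<open>auto intro!: list_all2_appendI list.rel_refl\<close>)
      then have "realizable n (steps ?o bs1 @ u # [] @ \<nu> # R)" unfolding R by simp
      then show ?thesis using fund min_up min_\<nu>p by (intro realizable_cone[where gs = "[]"]) auto
    next
      assume "\<not> t < n" and T0: "T = {}"
      then have \<nu>u: "wt_eq n \<nu> u" using top tn by (auto simp: q_def ind_def)
      have "realizable n (steps ?o (bs1 @ cs) @ tot ?o (bs1 @ cs) # zs)"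
        by (rule base) (use bs1 cs tot_cong[OF wt_eq_sym[OF \<nu>u]] in \<open>auto simp: tot_append u_def\<close>)
      then have "realizable n (steps ?o bs1 @ (steps u cs @ tot u cs # zs))"
        by (simp add: steps_append tot_append u_def)
      then have "realizable n (steps ?o bs1 @ (steps \<nu> cs @ tot \<nu> cs # zs))"
        by (rule realizable_cong_append)
          (use steps_cong[OF wt_eq_sym[OF \<nu>u]] tot_cong[OF wt_eq_sym[OF \<nu>u]] in
            \<open>auto intro!: list_all2_appendI list.rel_refl\<close>)
      then have "realizable n (steps ?o bs1 @ \<nu> # p # \<nu> # R)"
        unfolding R by (rule realizable_cap) (rule fund_step_cong[OF fund wt_eq_sym[OF \<nu>u]], simp)
      then show ?thesis
        by (rule realizable_cong_append) (use \<nu>u in \<open>auto intro!: list.rel_refl\<close>)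
    qed
    have "realizable n (steps ?o (as @ cs' @ [x]) @ tot ?o (as @ cs' @ [x]) # \<nu> # R)"
      using goal by (simp add: steps_append tot_append bs1_def u_def p)
    from realizable_move[OF bs1(4,3) this] show ?thesis unfolding R split by simp
  qed
qed

lemma realizable_chain:
  assumes "set bs \<subseteq> {1..<n}" "successively (minuscule_step n) (tot wt_zero bs # zs)"
    "\<forall>z\<in>set zs. dominant n z" "wt_eq n (last (tot wt_zero bs # zs)) wt_zero"
  shows "realizable n (steps wt_zero bs @ tot wt_zero bs # zs)"
  using assms
proof (induction zs arbitrary: bs)
  case Nil
  have "bs = []"
  proof (rule ccontr)
    assume "bs \<noteq> []"
    then have n: "2 \<le> n" using Nil.prems(1) by (cases bs) auto
    have "tot wt_zero bs 1 = int (length bs)" "tot wt_zero bs n = 0"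
      using Nil.prems(1) by (induction bs) (auto simp: tot_apply wt_zero_def ind_def)
    moreover obtain c where "\<forall>i\<in>{1..n}. tot wt_zero bs i = c" using Nil.prems(4) by (auto simp: wt_eq_def wt_zero_def)
    ultimately show False using n \<open>bs \<noteq> []\<close> by auto
  qed
  then show ?case using realizable_zero by simp
next
  case (Cons v zs)
  have "minuscule_step n (tot wt_zero bs) v" using Cons.prems(2) by simp
  then obtain S where S: "S \<subseteq> {1..n}" "S \<noteq> {}" "S \<noteq> {1..n}" "wt_eq n v (\<lambda>i. tot wt_zero bs i + ind S i)"
    unfolding minuscule_step_def by blast
  define \<nu> where "\<nu> = (\<lambda>i. tot wt_zero bs i + ind S i)"
  have v\<nu>: "wt_eq n v \<nu>" using S(4) by (simp add: \<nu>_def)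
  have "realizable n (steps wt_zero bs @ tot wt_zero bs # steps \<nu> [] @ tot \<nu> [] # zs)"
  proof (rule realizable_strip[OF Cons.prems(1) _ S(1-3) \<nu>_def])
    show "dominant n \<nu>" using Cons.prems(3) dominant_cong[OF _ v\<nu>] by simp
    fix ds assume ds: "set ds \<subseteq> {1..<n}" "wt_eq n (tot wt_zero ds) (tot \<nu> [])"
    then have dv: "wt_eq n v (tot wt_zero ds)" using wt_eq_trans[OF v\<nu> wt_eq_sym] by simp
    show "realizable n (steps wt_zero ds @ tot wt_zero ds # zs)"
    proof (rule Cons.IH[OF ds(1)])
      show "successively (minuscule_step n) (tot wt_zero ds # zs)"
        using Cons.prems(2) minuscule_step_cong[OF _ dv wt_eq_refl] by (auto simp: successively_Cons)
      show "wt_eq n (last (tot wt_zero ds # zs)) wt_zero"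
        using Cons.prems(4) wt_eq_trans[OF wt_eq_sym[OF dv]] by (auto split: if_splits)
    qed (use Cons.prems(3) in auto)
  qed simp
  then have "realizable n ((steps wt_zero bs @ [tot wt_zero bs]) @ (\<nu> # zs))" by simp
  then have "realizable n ((steps wt_zero bs @ [tot wt_zero bs]) @ (v # zs))"
    by (rule realizable_cong_append) (use wt_eq_sym[OF v\<nu>] in \<open>auto intro!: list.rel_refl\<close>)
  then show ?case by simp
qed

section \<open>Dominance order, orbits and labels\<close>

definition root_comb :: "nat \<Rightarrow> (nat \<Rightarrow> nat \<Rightarrow> nat) \<Rightarrow> weight" where
  "root_comb n c = (\<lambda>t. \<Sum>i\<in>{1..n}. \<Sum>j\<in>{i<..n}.
     int (c i j) * ((if t = i then 1 else 0) - (if t = j then 1 else 0)))"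

lemma wt_le_alt: "wt_le n x y \<longleftrightarrow> (\<exists>c k. \<forall>i\<in>{1..n}. y i = x i + root_comb n c i + k)"
  unfolding wt_le_def wt_eq_def wt_diff_def root_comb_def[symmetric]
  by (intro ex_cong1 ball_cong refl) (auto simp: algebra_simps)

lemma root_comb_add: "root_comb n (\<lambda>i j. c i j + c' i j) t = root_comb n c t + root_comb n c' t"
  unfolding root_comb_def sum.distrib[symmetric] by (intro sum.cong refl) (simp add: distrib_right)

lemma wt_le_trans: assumes "wt_le n x y" "wt_le n y z" shows "wt_le n x z"
proof -
  obtain c k c' k' where "\<forall>i\<in>{1..n}. y i = x i + root_comb n c i + k" "\<forall>i\<in>{1..n}. z i = y i + root_comb n c' i + k'"
    using assms unfolding wt_le_alt by blast
  then have "\<forall>i\<in>{1..n}. z i = x i + root_comb n (\<lambda>i j. c i j + c' i j) i + (k + k')"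
    by (auto simp: root_comb_add)
  then show ?thesis unfolding wt_le_alt by blast
qed

lemma wt_eq_imp_le: assumes "wt_eq n x y" shows "wt_le n x y"
proof -
  obtain k where "\<forall>i\<in>{1..n}. y i = x i + k" using wt_eq_sym[OF assms] unfolding wt_eq_def by blast
  then have "\<forall>i\<in>{1..n}. y i = x i + root_comb n (\<lambda>_ _. 0) i + k" by (simp add: root_comb_def)
  then show ?thesis unfolding wt_le_alt by blast
qed

lemma wt_le_add: assumes "wt_le n x y" shows "wt_le n (\<lambda>i. x i + v i) (\<lambda>i. y i + v i)"
  using assms unfolding wt_le_alt by (auto simp: algebra_simps)

text \<open>Pairing with twice the half sum of positive coroots: it vanishes on constant vectors and
is positive on positive roots.\<close>
definition height :: "nat \<Rightarrow> weight \<Rightarrow> int" where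
  "height n x = (\<Sum>i\<in>{1..n}. (int n + 1 - 2 * int i) * x i)"

lemma height_const: "(\<Sum>i\<in>{1..n}. (int n + 1 - 2 * int i) * k) = 0"
proof -
  have "(\<Sum>i\<in>{1..n}. 2 * int i) = int n * (int n + 1)"
    by (induction n) (auto simp: algebra_simps)
  then have "(\<Sum>i\<in>{1..n}. int n + 1 - 2 * int i) = 0"
    by (simp add: sum_subtractf algebra_simps)
  then show ?thesis by (simp add: sum_distrib_right[symmetric])
qed

lemma height_root_comb: "height n (root_comb n c) = (\<Sum>i\<in>{1..n}. \<Sum>j\<in>{i<..n}. int (c i j) * (2 * (int j - int i)))"
proof -
  let ?w = "\<lambda>t. int n + 1 - 2 * int t"
  have "height n (root_comb n c) = (\<Sum>t\<in>{1..n}. \<Sum>i\<in>{1..n}. \<Sum>j\<in>{i<..n}.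
      int (c i j) * (?w t * (if t = i then 1 else 0) - ?w t * (if t = j then 1 else 0)))"
    unfolding height_def root_comb_def by (simp add: sum_distrib_left algebra_simps)
  also have "\<dots> = (\<Sum>i\<in>{1..n}. \<Sum>t\<in>{1..n}. \<Sum>j\<in>{i<..n}.
      int (c i j) * (?w t * (if t = i then 1 else 0) - ?w t * (if t = j then 1 else 0)))"
    by (rule sum.swap)
  also have "\<dots> = (\<Sum>i\<in>{1..n}. \<Sum>j\<in>{i<..n}. \<Sum>t\<in>{1..n}.
      int (c i j) * (?w t * (if t = i then 1 else 0) - ?w t * (if t = j then 1 else 0)))"
    by (intro sum.cong refl sum.swap)
  also have "\<dots> = (\<Sum>i\<in>{1..n}. \<Sum>j\<in>{i<..n}. int (c i j) * (2 * (int j - int i)))"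
  proof (intro sum.cong refl)
    fix i j assume ij: "i \<in> {1..n}" "j \<in> {i<..n}"
    then have d: "(\<Sum>t\<in>{1..n}. ?w t * (if t = i then 1 else 0)) = ?w i" "(\<Sum>t\<in>{1..n}. ?w t * (if t = j then 1 else 0)) = ?w j"
      by (simp_all add: if_distrib cong: if_cong)
    have "(\<Sum>t\<in>{1..n}. int (c i j) * (?w t * (if t = i then 1 else 0) - ?w t * (if t = j then 1 else 0)))
      = int (c i j) * (?w i - ?w j)"
      unfolding sum_distrib_left[symmetric] sum_subtractf d ..
    also have "?w i - ?w j = 2 * (int j - int i)" by (simp add: algebra_simps)
    finally show "(\<Sum>t\<in>{1..n}. int (c i j) * (?w t * (if t = i then 1 else 0) - ?w t * (if t = j then 1 else 0)))
      = int (c i j) * (2 * (int j - int i))" .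
  qed
  finally show ?thesis .
qed

lemma wt_le_antisym: assumes "wt_le n x y" "wt_le n y x" shows "wt_eq n x y"
proof -
  have step: "height n y = height n x + height n (root_comb n c)"
    if "\<forall>i\<in>{1..n}. y i = x i + root_comb n c i + k" for c k x y
  proof -
    have "height n y = (\<Sum>i\<in>{1..n}. (int n + 1 - 2 * int i) * (x i + root_comb n c i + k))"
      unfolding height_def by (intro sum.cong refl) (use that in auto)
    then show ?thesis
      using height_const[of n k] by (simp add: height_def distrib_left sum.distrib)
  qed
  have nonneg: "0 \<le> int (c i j) * (2 * (int j - int i))" if "j \<in> {i<..n}" for c i j using that by auto
  obtain c k c' k' where 1: "\<forall>i\<in>{1..n}. y i = x i + root_comb n c i + k"
    and 2: "\<forall>i\<in>{1..n}. x i = y i + root_comb n c' i + k'"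
    using assms unfolding wt_le_alt by blast
  have "height n (root_comb n c) + height n (root_comb n c') = 0" using step[OF 1] step[OF 2] by simp
  moreover have "0 \<le> height n (root_comb n c)" "0 \<le> height n (root_comb n c')"
    unfolding height_root_comb by (intro sum_nonneg nonneg; assumption)+
  ultimately have z: "(\<Sum>i\<in>{1..n}. \<Sum>j\<in>{i<..n}. int (c i j) * (2 * (int j - int i))) = 0"
    by (simp add: height_root_comb)
  have inner: "(\<Sum>j\<in>{i<..n}. int (c i j) * (2 * (int j - int i))) = 0" if "i \<in> {1..n}" for i
    using z that nonneg by (subst (asm) sum_nonneg_eq_0_iff) (auto intro!: sum_nonneg)
  have "c i j = 0" if "i \<in> {1..n}" "j \<in> {i<..n}" for i j
    using inner[OF that(1)] that(2) nonneg by (subst (asm) sum_nonneg_eq_0_iff) auto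
  then have "root_comb n c t = 0" for t unfolding root_comb_def by (intro sum.neutral ballI) auto
  then have "wt_eq n y x" using 1 unfolding wt_eq_def by (intro exI[of _ k]) simp
  then show ?thesis by (rule wt_eq_sym)
qed

lemma ind_le_omega:
  assumes "S \<subseteq> {1..n}" shows "wt_le n (ind S) (ind {1..card S})"
proof -
  let ?A = "{1..card S} - S" and ?B = "S - {1..card S}"
  have fin: "finite S" using assms finite_subset by blast
  have cn: "card S \<le> n" using card_mono[OF _ assms] by simp
  have "card {1..card S} = card S" by simp
  then have "card ?A = card ?B" using card_Diff_subset_Int fin
    by (simp add: card_Diff_subset_Int Int_commute)
  then obtain g where g: "bij_betw g ?A ?B" using fin finite_same_card_bij by blast
  define c where "c i j = (if i \<in> ?A \<and> j = g i then 1 else 0 :: nat)" for i j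
  have gB: "g i \<in> ?B" if "i \<in> ?A" for i using g that by (auto simp: bij_betw_def)
  have "root_comb n c t = ind {1..card S} t - ind S t" if t: "t \<in> {1..n}" for t
  proof -
    have "root_comb n c t = (\<Sum>i\<in>{1..n}. if i \<in> ?A then (if t = i then 1 else 0) - (if t = g i then 1 else 0) else 0)"
      unfolding root_comb_def
    proof (intro sum.cong refl)
      fix i assume i: "i \<in> {1..n}"
      show "(\<Sum>j\<in>{i<..n}. int (c i j) * ((if t = i then 1 else 0) - (if t = j then 1 else 0)))
        = (if i \<in> ?A then (if t = i then 1 else 0) - (if t = g i then 1 else 0) else 0)"
      proof (cases "i \<in> ?A")
        case True
        then have "g i \<in> {i<..n}" using gB[OF True] assms by auto
        have "(\<Sum>j\<in>{i<..n}. int (c i j) * ((if t = i then 1 else 0) - (if t = j then 1 else 0)))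
          = (\<Sum>j\<in>{i<..n}. if j = g i then (if t = i then 1 else 0) - (if t = g i then 1 else 0) else 0)"
          using True by (intro sum.cong) (auto simp: c_def)
        then show ?thesis using True \<open>g i \<in> {i<..n}\<close> by simp
      next
        case False
        then have "c i j = 0" for j by (auto simp: c_def)
        then show ?thesis using False by simp
      qed
    qed
    also have "\<dots> = (\<Sum>i\<in>?A. (if t = i then 1 else 0) - (if t = g i then 1 else 0))"
      using cn by (subst sum.inter_restrict[symmetric]) (auto intro!: sum.cong)
    also have "\<dots> = (\<Sum>i\<in>?A. if t = i then 1 else 0) - (\<Sum>i\<in>?A. if t = g i then 1 else 0)"
      by (rule sum_subtractf)
    also have "(\<Sum>i\<in>?A. if t = g i then 1 else 0) = (\<Sum>i\<in>?B. if t = i then 1 else (0::int))"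
      by (rule sum.reindex_bij_betw[OF g, of "\<lambda>i. if t = i then 1 else 0"])
    finally show ?thesis using fin t by (auto simp: ind_def)
  qed
  then show ?thesis unfolding wt_le_alt by (intro exI[of _ c] exI[of _ 0]) auto
qed

lemma omega_ind: "a < n \<Longrightarrow> omega n a = ind {1..a}"
  by (auto simp: omega_def ind_def fun_eq_iff)

lemma wt_eq_diff: "wt_eq n x x' \<Longrightarrow> wt_eq n y y' \<Longrightarrow> wt_eq n (wt_diff x y) (wt_diff x' y')"
proof -
  assume "wt_eq n x x'" "wt_eq n y y'"
  then obtain c d where "\<forall>i\<in>{1..n}. x i = x' i + c" "\<forall>i\<in>{1..n}. y i = y' i + d" by (auto simp: wt_eq_def)
  then show ?thesis unfolding wt_eq_def wt_diff_def by (intro exI[of _ "c - d"]) auto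
qed

lemma wt_diff_iff: "wt_eq n (wt_diff y x) v \<longleftrightarrow> wt_eq n y (\<lambda>i. x i + v i)"
  unfolding wt_eq_def wt_diff_def by (intro ex_cong1 ball_cong refl) auto

lemma in_W_orbitI:
  assumes S: "S \<subseteq> {1..n}" "card S = a" "a < n" and x: "wt_eq n x (ind S)"
  shows "in_W_orbit n x (omega n a)"
proof -
  have fin: "finite S" using S(1) finite_subset by blast
  obtain f where f: "bij_betw f S {1..a}" using finite_same_card_bij[OF fin, of "{1..a}"] S(2) by auto
  have "card ({1..n} - S) = card {a<..n}" using S fin by (simp add: card_Diff_subset)
  then obtain g where g: "bij_betw g ({1..n} - S) {a<..n}" using finite_same_card_bij[of "{1..n} - S" "{a<..n}"] by auto
  define p where "p i = (if i \<in> S then f i else if i \<in> {1..n} then g i else i)" for i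
  have "bij_betw p S {1..a}" using f by (subst bij_betw_cong[of S p f]) (auto simp: p_def)
  moreover have "bij_betw p ({1..n} - S) {a<..n}" using g by (subst bij_betw_cong[of _ p g]) (auto simp: p_def)
  ultimately have "bij_betw p (S \<union> ({1..n} - S)) ({1..a} \<union> {a<..n})"
    by (rule bij_betw_combine) auto
  moreover have "S \<union> ({1..n} - S) = {1..n}" "{1..a} \<union> {a<..n} = {1..n}" using S by auto
  ultimately have p: "p permutes {1..n}" using S(1) by (intro bij_imp_permutes) (auto simp: p_def)
  have "(omega n a \<circ> p) i = ind S i" if "i \<in> {1..n}" for i
  proof (cases "i \<in> S")
    case True
    then have "f i \<in> {1..a}" using f by (auto simp: bij_betw_def)
    then show ?thesis using True S(3) by (auto simp: omega_ind ind_def p_def)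
  next
    case False
    then have "g i \<in> {a<..n}" using g that by (auto simp: bij_betw_def)
    then show ?thesis using False that S(3) by (auto simp: omega_ind ind_def p_def)
  qed
  then have "wt_eq n (ind S) (omega n a \<circ> p)" unfolding wt_eq_def by (intro exI[of _ 0]) auto
  then show ?thesis using p wt_eq_trans[OF x] unfolding in_W_orbit_def by blast
qed

lemma in_W_orbitE:
  assumes orb: "in_W_orbit n x \<gamma>" and \<gamma>: "wt_eq n \<gamma> (omega n a)" "a < n"
  obtains S where "S \<subseteq> {1..n}" "card S = a" "wt_eq n x (ind S)"
proof -
  obtain p where p: "p permutes {1..n}" "wt_eq n x (\<gamma> \<circ> p)" using orb by (auto simp: in_W_orbit_def)
  define S where "S = {i\<in>{1..n}. p i \<in> {1..a}}"
  have "p ` S = {1..a}"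
  proof
    show "{1..a} \<subseteq> p ` S"
    proof
      fix j assume j: "j \<in> {1..a}"
      then have "j \<in> p ` {1..n}" using permutes_image[OF p(1)] \<gamma>(2) by auto
      then show "j \<in> p ` S" using j by (auto simp: S_def)
    qed
  qed (auto simp: S_def)
  then have "card S = a" using card_image[OF permutes_inj_on[OF p(1)], of S] by simp
  obtain c where c: "\<forall>i\<in>{1..n}. \<gamma> i = omega n a i + c" using \<gamma>(1) by (auto simp: wt_eq_def)
  have "(\<gamma> \<circ> p) i = ind S i + c" if "i \<in> {1..n}" for i
  proof -
    have "p i \<in> {1..n}" using permutes_in_image[OF p(1)] that by auto
    then show ?thesis using c that \<gamma>(2) by (auto simp: omega_ind ind_def S_def)
  qed
  then have "wt_eq n (\<gamma> \<circ> p) (ind S)" unfolding wt_eq_def by blast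
  then have "wt_eq n x (ind S)" by (rule wt_eq_trans[OF p(2)])
  moreover have "S \<subseteq> {1..n}" by (auto simp: S_def)
  ultimately show ?thesis using that \<open>card S = a\<close> by blast
qed

definition size_mod :: "nat \<Rightarrow> weight \<Rightarrow> weight \<Rightarrow> nat" where
  "size_mod n x y = nat ((sum y {1..n} - sum x {1..n}) mod int n)"

lemma size_mod_eq:
  assumes "S \<subseteq> {1..n}" "card S < n" "wt_eq n y (\<lambda>i. x i + ind S i)" shows "size_mod n x y = card S"
proof -
  obtain c where "\<forall>i\<in>{1..n}. y i = x i + ind S i + c" using assms(3) by (auto simp: wt_eq_def)
  then have "sum y {1..n} = (\<Sum>i\<in>{1..n}. x i + ind S i + c)" by (intro sum.cong) auto
  also have "\<dots> = sum x {1..n} + (\<Sum>i\<in>{1..n}. ind S i) + int n * c" by (simp add: sum.distrib)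
  also have "(\<Sum>i\<in>{1..n}. ind S i) = int (card S)"
    using assms(1) by (simp add: ind_def sum.If_cases Int_absorb1)
  finally have "sum y {1..n} - sum x {1..n} = int (card S) + int n * c" by simp
  then show ?thesis using assms(2) by (simp add: size_mod_def)
qed

lemma minuscule_stepE:
  assumes "minuscule_step n x y"
  obtains S where "S \<subseteq> {1..n}" "card S = size_mod n x y" "1 \<le> card S" "card S < n"
    "wt_eq n y (\<lambda>i. x i + ind S i)"
proof -
  obtain S where S: "S \<subseteq> {1..n}" "S \<noteq> {}" "S \<noteq> {1..n}" "wt_eq n y (\<lambda>i. x i + ind S i)"
    using assms unfolding minuscule_step_def by blast
  have "card S < card {1..n}" by (rule psubset_card_mono) (use S in auto)
  then have "card S < n" by simp
  moreover have "1 \<le> card S" using S finite_subset[OF S(1)] by (simp add: Suc_le_eq card_gt_0_iff)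
  ultimately show ?thesis using that[of S] S size_mod_eq[OF S(1) _ S(4)] by auto
qed

lemma fund_stepE:
  assumes "fund_step n x y" shows "wt_eq n y (\<lambda>i. x i + omega n (size_mod n x y) i)"
proof -
  obtain b where b: "b \<in> {1..<n}" "wt_eq n y (\<lambda>i. x i + ind {1..b} i)"
    using assms unfolding fund_step_def by blast
  have "size_mod n x y = b" using size_mod_eq[of "{1..b}" n y x] b by auto
  then show ?thesis using b by (simp add: omega_ind)
qed

lemma size_mod_swap: 
  assumes "minuscule_step n x y" shows "size_mod n y x = n - size_mod n x y"
proof -
  have "1 \<le> size_mod n x y" "size_mod n x y < n" using assms by (auto elim: minuscule_stepE)
  moreover define s where "s = sum y {1..n} - sum x {1..n}"
  have "sum x {1..n} - sum y {1..n} = - s" by (simp add: s_def)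
  ultimately show ?thesis unfolding size_mod_def s_def[symmetric]
    by (auto simp: zmod_zminus1_eq_if nat_diff_distrib)
qed

section \<open>Coherence\<close>

lemma successively_iff_nth:
  "successively P xs \<longleftrightarrow> (\<forall>i. Suc i < length xs \<longrightarrow> P (xs ! i) (xs ! Suc i))"
proof (induction xs)
  case (Cons x xs)
  show ?case
  proof (cases xs)
    case (Cons y ys)
    then have "successively P (x # xs) \<longleftrightarrow> P x y \<and> successively P xs" by simp
    also have "\<dots> \<longleftrightarrow> (\<forall>i. Suc i < length (x # xs) \<longrightarrow> P ((x # xs) ! i) ((x # xs) ! Suc i))"
      unfolding Cons.IH using Cons by (auto simp: nth_Cons split: nat.splits)
    finally show ?thesis .
  qed simp
qed simp

lemma reach_lab_update: "reach n W \<delta> d \<Longrightarrow> reach n (W\<lparr>lab := l\<rparr>) \<delta> d"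
proof (induction rule: reach.induct)
  case reach_hd
  show ?case using reach.reach_hd[of n "W\<lparr>lab := l\<rparr>" \<delta>] by simp
next
  case (reach_phi d)
  then show ?case using reach.reach_phi[of n "W\<lparr>lab := l\<rparr>" \<delta> d] by (simp add: inner_def phi_def)
next
  case (reach_al d)
  then show ?case using reach.reach_al[of n "W\<lparr>lab := l\<rparr>" \<delta> d] by simp
qed

lemma coreach_lab_update: "coreach n W \<delta> d \<Longrightarrow> coreach n (W\<lparr>lab := l\<rparr>) \<delta> d"
proof (induction rule: coreach.induct)
  case (coreach_cd d)
  then show ?case using coreach.coreach_cd[of d "W\<lparr>lab := l\<rparr>" n \<delta>] by simp
next
  case (coreach_phi d)
  then show ?case using coreach.coreach_phi[of n "W\<lparr>lab := l\<rparr>" \<delta> d] by (simp add: inner_def phi_def)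
next
  case (coreach_al d)
  then show ?case using coreach.coreach_al[of n "W\<lparr>lab := l\<rparr>" \<delta> d] by simp
qed

lemma potential_lab_update: "potential n W \<delta> \<Longrightarrow> potential n (W\<lparr>lab := l\<rparr>) \<delta>"
  unfolding potential_def inner_def phi_def by (auto intro: reach_lab_update coreach_lab_update)

lemma disk_map_lab_update [simp]: "disk_map (W\<lparr>lab := l\<rparr>) \<longleftrightarrow> disk_map W"
  by (simp add: disk_map_def arc_def darts_def)

lemma walk_append: "walk W f ds g \<Longrightarrow> walk W g ds' h \<Longrightarrow> walk W f (ds @ ds') h"
  by (induction ds arbitrary: f) auto

lemma len_append: "len n W (ds @ ds') i = len n W ds i + len n W ds' i"
  by (induction ds) (auto simp: wt_zero_def)

locale labelled_disk = disk +
  fixes n :: nat and \<delta> :: "nat \<Rightarrow> weight"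
  assumes pot: "potential n W \<delta>" and start: "wt_eq n (\<delta> (hd (cd W))) wt_zero"
    and lab: "\<And>d. lab W d = size_mod n (\<delta> (al W d)) (\<delta> d)"
begin

lemma \<delta>_phi: "d \<in> inner W \<Longrightarrow> \<delta> (phi W d) = \<delta> d"
  and step: "d \<in> wd W \<Longrightarrow> minuscule_step n (\<delta> d) (\<delta> (al W d))"
  and reach: "d \<in> inner W \<Longrightarrow> reach n W \<delta> d" and coreach: "d \<in> inner W \<Longrightarrow> coreach n W \<delta> d"
  using pot by (auto simp: potential_def)

lemma wd_inner: "d \<in> wd W \<Longrightarrow> d \<in> inner W" and cd_inner: "d \<in> set (cd W) \<Longrightarrow> d \<in> inner W"
  by (auto simp: inner_def)

lemma last_nth: "cd W ! nbd W = last (cd W)" and hd_nth: "cd W ! 0 = hd (cd W)"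
  using cd_nonempty by (simp_all add: nbd_def last_conv_nth hd_conv_nth)

lemma length_cd: "length (cd W) = Suc (nbd W)"
  using cd_nonempty by (simp add: nbd_def)

lemma arc_nth: "i < nbd W \<Longrightarrow> arc W (cd W ! i) (cd W ! Suc i)"
  using arcs length_cd by (simp add: successively_iff_nth)

lemma bdart: 
  assumes "i < nbd W"
  shows "bdart W i \<in> wd W" "sg W (bdart W i) = cd W ! Suc i" "sg W (cd W ! Suc i) = al W (cd W ! i)"
    "\<delta> (bdart W i) = \<delta> (cd W ! i)" "\<delta> (al W (bdart W i)) = \<delta> (cd W ! Suc i)"
proof -
  show b: "bdart W i \<in> wd W" and s: "sg W (bdart W i) = cd W ! Suc i"
    and "sg W (cd W ! Suc i) = al W (cd W ! i)"
    using arc_nth[OF assms] by (auto simp: arc_def bdart_def)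
  have "bdart W i = phi W (cd W ! i)" by (simp add: bdart_def phi_def)
  then show "\<delta> (bdart W i) = \<delta> (cd W ! i)" using assms length_cd by (auto intro!: \<delta>_phi cd_inner)
  have "phi W (al W (bdart W i)) = cd W ! Suc i" using s by (simp add: phi_def)
  then show "\<delta> (al W (bdart W i)) = \<delta> (cd W ! Suc i)" using \<delta>_phi[of "al W (bdart W i)"] b by (simp add: wd_inner)
qed

lemma sg_inj: "sg W u = sg W v \<Longrightarrow> u = v"
  using permutes_inj[OF sg_perm] by (auto dest: injD)

lemma sg_internal:
  assumes b: "b \<in> wd W" "b \<notin> bdart W ` {..<nbd W}" shows "sg W b \<in> wd W"
proof (rule ccontr)
  assume n: "sg W b \<notin> wd W"
  have "phi W (al W b) \<in> inner W" using b by (intro inner_phi wd_inner) simp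
  then have "sg W b \<in> set (cd W)" using n by (simp add: phi_def inner_def)
  then obtain j where j: "j < length (cd W)" "sg W b = cd W ! j" by (metis in_set_conv_nth)
  show False
  proof (cases j)
    case 0
    then have "b = al W (last (cd W))" using j hd_nth sg_last by - (rule sg_inj, simp)
    then show False using b(1) al_cd_wd[of "last (cd W)"] cd_nonempty by auto
  next
    case (Suc i)
    then have "i < nbd W" using j length_cd by simp
    then have "b = bdart W i" using bdart(2)[of i] j Suc by - (rule sg_inj, simp)
    then show False using b(2) \<open>i < nbd W\<close> by auto
  qed
qed

lemma triv_wd: "d \<in> wd W \<Longrightarrow> sg W d \<noteq> d \<and> sg W (sg W (sg W d)) = d"
  using cd_wd[of "hd (cd W)"] al_cd_wd[of "last (cd W)"] cd_nonempty by (intro triv wd_darts) auto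

lemma labels:
  assumes "d \<in> wd W" shows "lab W d \<in> {1..n - 1}" "lab W (al W d) = n - lab W d"
proof -
  have m: "minuscule_step n (\<delta> (al W d)) (\<delta> d)" using step[OF assms] by (rule minuscule_step_sym)
  then show "lab W d \<in> {1..n - 1}" unfolding lab by (auto elim: minuscule_stepE)
  show "lab W (al W d) = n - lab W d" unfolding lab using size_mod_swap[OF m] by simp
qed

lemma internal_vertex:
  assumes d: "d \<in> wd W" "d \<notin> bdart W ` {..<nbd W}"
  shows "card (orb (sg W) d) = 3" "orb (sg W) d \<subseteq> wd W" "(\<Sum>x\<in>orb (sg W) d. lab W x) mod n = 0"
proof -
  let ?s = "sg W"
  have notb: "?s b \<notin> bdart W ` {..<nbd W}" if "b \<in> wd W" for b
  proof
    assume "?s b \<in> bdart W ` {..<nbd W}"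
    then obtain i where i: "i < nbd W" "?s b = ?s (al W (cd W ! i))" by (auto simp: bdart_def)
    then have "b = al W (cd W ! i)" by - (rule sg_inj, simp)
    then show False using that al_cd_wd[of "cd W ! i"] i length_cd by auto
  qed
  have 1: "?s d \<in> wd W" by (rule sg_internal[OF d])
  have 2: "?s (?s d) \<in> wd W" by (rule sg_internal[OF 1 notb[OF d(1)]])
  have t: "?s d \<noteq> d" "?s (?s (?s d)) = d" using triv_wd[OF d(1)] by auto
  have t2: "?s (?s d) \<noteq> ?s d" "?s (?s d) \<noteq> d" using t sg_inj by metis+
  have o: "orb ?s d = {d, ?s d, ?s (?s d)}"
  proof
    show "orb ?s d \<subseteq> {d, ?s d, ?s (?s d)}" by (rule orb_least) (use t in auto)
    show "{d, ?s d, ?s (?s d)} \<subseteq> orb ?s d" using orb_step[of d ?s d] orb_step[of "?s d" ?s d] by simp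
  qed
  then show "card (orb ?s d) = 3" "orb ?s d \<subseteq> wd W" using t t2 d 1 2 by auto
  have n: "n > 0" using labels(1)[OF d(1)] by auto
  define \<sigma> where "\<sigma> x = sum (\<delta> x) {1..n}" for x
  have L: "int (lab W x) = (\<sigma> x - \<sigma> (?s x)) mod int n" if "x \<in> wd W" for x
  proof -
    have "\<delta> (al W x) = \<delta> (?s x)" using \<delta>_phi[of "al W x"] that by (simp add: phi_def wd_inner)
    then show ?thesis using n by (simp add: lab size_mod_def \<sigma>_def)
  qed
  have "int ((\<Sum>x\<in>orb ?s d. lab W x) mod n) = (int (lab W d) + int (lab W (?s d)) + int (lab W (?s (?s d)))) mod int n"
    using o t t2 by (simp add: zmod_int add.assoc)
  also have "\<dots> = ((\<sigma> d - \<sigma> (?s d)) + (\<sigma> (?s d) - \<sigma> (?s (?s d))) + (\<sigma> (?s (?s d)) - \<sigma> d)) mod int n"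
    unfolding L[OF d(1)] L[OF 1] L[OF 2] t(2) by (metis mod_add_eq mod_add_left_eq)
  also have "\<dots> = 0" by simp
  finally show "(\<Sum>x\<in>orb ?s d. lab W x) mod n = 0" by simp
qed

lemma is_web: "is_web n W"
  unfolding is_web_def Let_def
proof (intro conjI)
  show "finite (wd W)" using finite_darts by (simp add: darts_def)
  show "wd W \<inter> set (cd W) = {}" "wd W \<inter> al W ` set (cd W) = {}" "set (cd W) \<inter> al W ` set (cd W) = {}"
    using disk by (auto simp: disk_map_def)
  show "\<forall>d\<in>darts W. al W (al W d) = d \<and> al W d \<noteq> d" using al_fixfree by simp
  show "sg W (cd W ! 0) = al W (cd W ! nbd W)" "sg W (al W (cd W ! nbd W)) = cd W ! 0"
    by (simp_all add: last_nth hd_nth sg_hd sg_last)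
  show "\<forall>i<nbd W. bdart W i \<in> wd W \<and> sg W (bdart W i) = cd W ! Suc i \<and> sg W (cd W ! Suc i) = al W (cd W ! i)"
    using bdart by blast
  show "\<forall>d\<in>wd W. lab W d \<in> {1..n - 1} \<and> lab W (al W d) = n - lab W d"
    using labels by blast
  show "\<forall>d\<in>wd W. d \<notin> bdart W ` {..<nbd W} \<longrightarrow>
      card (orb (sg W) d) = 3 \<and> orb (sg W) d \<subseteq> wd W \<and> (\<Sum>x\<in>orb (sg W) d. lab W x) mod n = 0"
    using internal_vertex by blast
  show "\<forall>x\<in>darts W. \<forall>y\<in>darts W. (x, y) \<in> ({(z, al W z) |z. z \<in> darts W} \<union> {(z, sg W z) |z. z \<in> darts W})\<^sup>*"
    using planar unfolding planar_map_def links_def by blast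
  show "2 * card (orbits (sg W) (darts W)) + 2 * card (orbits (phi W) (darts W)) = card (darts W) + 4"
    using planar unfolding planar_map_def phi_def by blast
qed (use cd_nonempty cd_distinct sg_perm in auto)

lemma face_inner: "d \<in> inner W \<Longrightarrow> d' \<in> face W d \<Longrightarrow> d' \<in> inner W \<and> \<delta> d' = \<delta> d"
proof -
  assume d: "d \<in> inner W" "d' \<in> face W d"
  have "face W d \<subseteq> {d' \<in> inner W. \<delta> d' = \<delta> d}"
    unfolding face_def by (rule orb_least) (use d \<delta>_phi inner_phi in auto)
  then show ?thesis using d by auto
qed

lemma face_\<delta>: "d \<in> inner W \<Longrightarrow> face W d = face W d' \<Longrightarrow> \<delta> d' = \<delta> d"
  using face_inner[of d d'] orb_self[of d' "phi W"] by (auto simp: face_def)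

lemma face_phi: "face W (phi W d) = face W d"
proof -
  have "phi W permutes darts W" unfolding phi_def by (rule permutes_compose[OF al_perm sg_perm])
  then show ?thesis unfolding face_def by (rule orb_eq[OF _ finite_darts]) (auto intro: orb_step)
qed

lemma dvert_inner: "dvert W = face W ` inner W"
  by (auto simp: dvert_def inner_def)

lemma mark_face: "mark W = face W (hd (cd W))"
  by (simp add: mark_def ext_def hd_nth)

lemma walk_single: "d \<in> wd W \<Longrightarrow> walk W (face W d) [d] (face W (al W d))"
  by (simp add: dvert_inner wd_inner)

lemma len_al: "fund_step n (\<delta> d) (\<delta> (al W d)) \<Longrightarrow> wt_eq n (\<delta> (al W d)) (\<lambda>i. \<delta> d i + omega n (lab W (al W d)) i)"
  unfolding lab al_al by (rule fund_stepE)

lemma reach_walk: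
  assumes "reach n W \<delta> d"
  shows "d \<in> inner W \<and> (\<exists>ds. walk W (mark W) ds (face W d) \<and> wt_eq n (len n W ds) (\<delta> d))"
  using assms
proof (induction rule: reach.induct)
  case reach_hd
  have h: "hd (cd W) \<in> inner W" using cd_nonempty by (intro cd_inner) simp
  then have "walk W (mark W) [] (face W (hd (cd W)))" by (simp add: mark_face dvert_inner)
  moreover have "wt_eq n (len n W []) (\<delta> (hd (cd W)))" using wt_eq_sym[OF start] by simp
  ultimately show ?case using h by blast
next
  case (reach_phi d)
  then show ?case using inner_phi by (auto simp: face_phi \<delta>_phi)
next
  case (reach_al d)
  then obtain ds where ds: "walk W (mark W) ds (face W d)" "wt_eq n (len n W ds) (\<delta> d)" by blast
  have "walk W (mark W) (ds @ [d]) (face W (al W d))" by (rule walk_append[OF ds(1) walk_single[OF reach_al(2)]])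
  moreover have "wt_eq n (len n W (ds @ [d])) (\<delta> (al W d))"
  proof -
    have "len n W (ds @ [d]) = (\<lambda>i. len n W ds i + omega n (lab W (al W d)) i)"
      by (auto simp: len_append wt_zero_def)
    then show ?thesis using wt_eq_add[OF ds(2)] wt_eq_sym[OF len_al[OF reach_al(3)]] wt_eq_trans by metis
  qed
  ultimately show ?case using reach_al(2) by (auto intro!: wd_inner)
qed

lemma coreach_walk:
  assumes "coreach n W \<delta> d"
  shows "d \<in> inner W \<and> (\<exists>i\<le>nbd W. \<exists>ds. walk W (face W d) ds (ext W i) \<and> wt_eq n (\<lambda>i. \<delta> d i + len n W ds i) (\<delta> (cd W ! i)))"
  using assms
proof (induction rule: coreach.induct)
  case (coreach_cd d)
  then obtain j where "j \<le> nbd W" "d = cd W ! j" using length_cd by (metis in_set_conv_nth less_Suc_eq_le)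
  moreover have "walk W (face W d) [] (face W d)" using coreach_cd by (auto simp: dvert_inner intro!: imageI cd_inner)
  ultimately show ?case using coreach_cd
    by (auto simp: ext_def wt_zero_def intro!: exI[of _ j] exI[of _ "[]"] cd_inner)
next
  case (coreach_phi d)
  then show ?case by (auto simp: face_phi \<delta>_phi)
next
  case (coreach_al d)
  then obtain i ds where i: "i \<le> nbd W" and ds: "walk W (face W (al W d)) ds (ext W i)"
    "wt_eq n (\<lambda>i. \<delta> (al W d) i + len n W ds i) (\<delta> (cd W ! i))" by blast
  have "walk W (face W d) (d # ds) (ext W i)" using ds(1) coreach_al(2) by simp
  moreover have "wt_eq n (\<lambda>i. \<delta> d i + len n W (d # ds) i) (\<delta> (cd W ! i))"
    using wt_eq_trans[OF wt_eq_sym[OF wt_eq_add[OF len_al[OF coreach_al(3)], of "len n W ds"]] ds(2)]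
    by (simp add: add.assoc)
  ultimately show ?case using i wd_inner[OF coreach_al(2)] by blast
qed

lemma walk_lower_bound:
  assumes "walk W (face W d) ds (face W d')" "d \<in> inner W" "d' \<in> inner W"
  shows "wt_le n (\<delta> d') (\<lambda>i. \<delta> d i + len n W ds i)"
  using assms
proof (induction ds arbitrary: d)
  case Nil
  then have "face W d = face W d'" by simp
  then have "\<delta> d' = \<delta> d" by (rule face_\<delta>[OF Nil(2)])
  then show ?case by (auto simp: wt_zero_def intro: wt_eq_imp_le)
next
  case (Cons e ds)
  have e: "e \<in> wd W" "\<delta> e = \<delta> d" "walk W (face W (al W e)) ds (face W d')"
    using Cons.prems face_\<delta>[of d e] by auto
  have IH: "wt_le n (\<delta> d') (\<lambda>i. \<delta> (al W e) i + len n W ds i)"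
    by (rule Cons.IH[OF e(3)]) (use e Cons.prems in \<open>auto intro: wd_inner\<close>)
  obtain S where S: "S \<subseteq> {1..n}" "card S = lab W (al W e)" "card S < n" "wt_eq n (\<delta> (al W e)) (\<lambda>i. \<delta> d i + ind S i)"
    using step[OF e(1)] e(2) unfolding lab by (auto elim: minuscule_stepE)
  have "wt_le n (ind S) (omega n (lab W (al W e)))" using ind_le_omega[OF S(1)] S(2,3) by (simp add: omega_ind)
  from wt_le_add[OF this, of "\<delta> d"] have "wt_le n (\<delta> (al W e)) (\<lambda>i. \<delta> d i + omega n (lab W (al W e)) i)"
    using wt_le_trans[OF wt_eq_imp_le[OF S(4)]] by (simp add: add.commute)
  from wt_le_trans[OF IH wt_le_add[OF this]] show ?case by (simp add: add.assoc)
qed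

lemma mark_lower_bound:
  assumes "walk W (mark W) ds (face W d)" "d \<in> inner W"
  shows "wt_le n (\<delta> d) (len n W ds)"
proof -
  have "hd (cd W) \<in> inner W" using cd_nonempty by (intro cd_inner) simp
  from walk_lower_bound[OF _ this assms(2)] assms(1)
  have "wt_le n (\<delta> d) (\<lambda>i. \<delta> (hd (cd W)) i + len n W ds i)" by (simp add: mark_face)
  moreover have "wt_eq n (\<lambda>i. \<delta> (hd (cd W)) i + len n W ds i) (len n W ds)"
    using wt_eq_add[OF start, of "len n W ds"] by (simp add: wt_zero_def)
  ultimately show ?thesis using wt_le_trans wt_eq_imp_le by blast
qed

lemma geodesic_iff:
  assumes d: "d \<in> inner W"
  shows "geodesic n W (mark W) ds (face W d) \<longleftrightarrow> walk W (mark W) ds (face W d) \<and> wt_eq n (len n W ds) (\<delta> d)"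
proof (intro iffI conjI)
  assume g: "geodesic n W (mark W) ds (face W d)"
  then show w: "walk W (mark W) ds (face W d)" by (simp add: geodesic_def)
  obtain ds0 where ds0: "walk W (mark W) ds0 (face W d)" "wt_eq n (len n W ds0) (\<delta> d)"
    using reach_walk[OF reach[OF d]] by blast
  then have "\<not> wt_lt n (len n W ds0) (len n W ds)" using g by (auto simp: geodesic_def)
  moreover have "wt_le n (len n W ds0) (len n W ds)"
    by (rule wt_le_trans[OF wt_eq_imp_le[OF ds0(2)] mark_lower_bound[OF w d]])
  ultimately have "wt_eq n (len n W ds0) (len n W ds)" by (simp add: wt_lt_def)
  then show "wt_eq n (len n W ds) (\<delta> d)" by (rule wt_eq_trans[OF wt_eq_sym ds0(2)])
next
  assume w: "walk W (mark W) ds (face W d) \<and> wt_eq n (len n W ds) (\<delta> d)"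
  have False if ds': "walk W (mark W) ds' (face W d)" "wt_lt n (len n W ds') (len n W ds)" for ds'
  proof -
    have "wt_le n (len n W ds) (len n W ds')"
      using w by (intro wt_le_trans[OF wt_eq_imp_le mark_lower_bound[OF ds'(1) d]]) simp
    then show False using wt_le_antisym ds'(2) by (auto simp: wt_lt_def)
  qed
  then show "geodesic n W (mark W) ds (face W d)" using w by (auto simp: geodesic_def)
qed

lemma dist_mark: 
  assumes d: "d \<in> inner W" shows "wt_eq n (dist n W (mark W) (face W d)) (\<delta> d)"
proof -
  have "\<exists>ds. geodesic n W (mark W) ds (face W d)"
    using reach_walk[OF reach[OF d]] geodesic_iff[OF d] by blast
  then have "geodesic n W (mark W) (SOME ds. geodesic n W (mark W) ds (face W d)) (face W d)" by (rule someI_ex)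
  then show ?thesis unfolding dist_def geodesic_iff[OF d] by blast
qed

lemma coherent: "coherent n W"
  unfolding coherent_def
proof (intro conjI ballI impI)
  fix v assume "v \<in> dvert W"
  then obtain d where d: "d \<in> inner W" "v = face W d" by (auto simp: dvert_inner)
  show "coherent_geodesics n W (mark W) v"
    unfolding coherent_geodesics_def d(2) geodesic_iff[OF d(1)] using wt_eq_trans wt_eq_sym by blast
next
  fix v assume "v \<in> dvert W"
  then obtain d where d: "d \<in> inner W" "v = face W d" by (auto simp: dvert_inner)
  obtain ds where ds: "walk W (mark W) ds v" "wt_eq n (len n W ds) (\<delta> d)"
    using reach_walk[OF reach[OF d(1)]] d(2) by blast
  obtain i ds' where i: "i \<le> nbd W" and ds': "walk W v ds' (ext W i)"
    "wt_eq n (\<lambda>i. \<delta> d i + len n W ds' i) (\<delta> (cd W ! i))"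
    using coreach_walk[OF coreach[OF d(1)]] d(2) by blast
  have ci: "cd W ! i \<in> inner W" using i length_cd by (intro cd_inner) simp
  have "len n W (ds @ ds') = (\<lambda>i. len n W ds i + len n W ds' i)" by (auto simp: len_append)
  then have "wt_eq n (len n W (ds @ ds')) (\<delta> (cd W ! i))"
    using wt_eq_trans[OF wt_eq_add[OF ds(2)] ds'(2)] by simp
  then have "geodesic n W (mark W) (ds @ ds') (ext W i)"
    using geodesic_iff[OF ci] walk_append[OF ds(1) ds'(1)] by (simp add: ext_def)
  moreover have "on_walk W v (ds @ ds') (ext W i)"
    using ds'(1) by (cases ds') (auto simp: on_walk_def)
  ultimately show "\<exists>i\<le>nbd W. \<exists>ds. geodesic n W (mark W) ds (ext W i) \<and> on_walk W v ds (ext W i)"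
    using i by blast
next
  fix d assume d: "d \<in> wd W"
  obtain S where S: "S \<subseteq> {1..n}" "card S = lab W (al W d)" "card S < n" "wt_eq n (\<delta> (al W d)) (\<lambda>i. \<delta> d i + ind S i)"
    using step[OF d] unfolding lab by (auto elim: minuscule_stepE)
  have "wt_eq n (wt_diff (dist n W (mark W) (face W (al W d))) (dist n W (mark W) (face W d))) (wt_diff (\<delta> (al W d)) (\<delta> d))"
    using d by (intro wt_eq_diff dist_mark wd_inner) auto
  moreover have "wt_eq n (wt_diff (\<delta> (al W d)) (\<delta> d)) (ind S)" using S(4) by (simp add: wt_diff_iff)
  ultimately have "wt_eq n (wt_diff (dist n W (mark W) (face W (al W d))) (dist n W (mark W) (face W d))) (ind S)"
    by (rule wt_eq_trans)
  then show "in_W_orbit n (wt_diff (dist n W (mark W) (face W (al W d))) (dist n W (mark W) (face W d)))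
      (omega n (lab W (al W d)))"
    using in_W_orbitI[OF S(1) refl S(3)] S(2) by simp
qed

end

lemma minuscule_orbitE:
  assumes "minuscule_dominant n lam" "in_W_orbit n (wt_diff y x) lam"
  obtains S where "S \<subseteq> {1..n}" "1 \<le> card S" "card S < n" "wt_eq n lam (omega n (card S))"
    "wt_eq n y (\<lambda>i. x i + ind S i)"
proof -
  obtain a where a: "a \<in> {1..n - 1}" "wt_eq n lam (omega n a)" using assms(1) by (auto simp: minuscule_dominant_def)
  then have an: "a < n" "1 \<le> a" by auto
  obtain S where "S \<subseteq> {1..n}" "card S = a" "wt_eq n (wt_diff y x) (ind S)"
    by (rule in_W_orbitE[OF assms(2) a(2) an(1)])
  then show ?thesis using that[of S] a an by (simp add: wt_diff_iff)
qed

lemma realizable_path: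
  assumes min: "\<forall>lam\<in>set lams. minuscule_dominant n lam" and P: "in_P n lams mus"
  shows "realizable n mus"
proof -
  have len: "length mus = Suc (length lams)" using P by (simp add: in_P_def)
  then obtain m ms where mus: "mus = m # ms" by (cases mus) auto
  have m0: "wt_eq n m wt_zero" using P by (simp add: in_P_def mus)
  have "minuscule_step n (mus ! i) (mus ! Suc i)" if i: "Suc i < length mus" for i
  proof -
    have "minuscule_dominant n (lams ! i)" "in_W_orbit n (wt_diff (mus ! Suc i) (mus ! i)) (lams ! i)"
      using P min i len by (auto simp: in_P_def)
    then obtain S where S: "S \<subseteq> {1..n}" "1 \<le> card S" "card S < n" "wt_eq n (mus ! Suc i) (\<lambda>j. (mus ! i) j + ind S j)"
      by (rule minuscule_orbitE)
    then have "S \<noteq> {}" "S \<noteq> {1..n}" by auto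
    then show ?thesis using S unfolding minuscule_step_def by blast
  qed
  then have "successively (minuscule_step n) mus" by (simp add: successively_iff_nth)
  then have chain: "successively (minuscule_step n) (tot wt_zero [] # ms)"
    using minuscule_step_cong[OF _ m0 wt_eq_refl] by (auto simp: mus successively_Cons)
  have dom: "\<forall>z\<in>set ms. dominant n z"
  proof
    fix z assume "z \<in> set ms"
    then have "z \<in> set mus" by (simp add: mus)
    then obtain i where "i \<le> length lams" "z = mus ! i" using len by (metis in_set_conv_nth less_Suc_eq_le)
    then show "dominant n z" using P by (simp add: in_P_def)
  qed
  have "last mus = mus ! length lams" using len by (subst last_conv_nth) auto
  then have "wt_eq n (last mus) wt_zero" using P by (simp add: in_P_def)
  then have "wt_eq n (last (tot wt_zero [] # ms)) wt_zero" by (auto simp: mus split: if_splits)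
  from realizable_chain[OF _ chain dom this] have "realizable n (wt_zero # ms)" by simp
  then show ?thesis unfolding mus
    by (rule realizable_cong) (use wt_eq_sym[OF m0] in \<open>auto intro!: list.rel_refl\<close>)
qed

theorem mainTheorem4:
  fixes n :: nat and lams mus :: "weight list"
  assumes "\<forall>lam\<in>set lams. minuscule_dominant n lam"
    and "in_P n lams mus"
  shows "\<exists>W. is_web n W \<and> coherent n W \<and> wt_list_eq n (web_boundary n W) lams
             \<and> wt_list_eq n (associated_path n W) mus"
proof -
  obtain W0 \<delta> where W0: "disk_map W0" "potential n W0 \<delta>" "wt_eq n (\<delta> (hd (cd W0))) wt_zero"
    "list_all2 (\<lambda>d f. wt_eq n (\<delta> d) f) (cd W0) mus"
    using realizable_path[OF assms] unfolding realizable_def by blast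
  define W where "W = W0\<lparr>lab := \<lambda>d. size_mod n (\<delta> (al W0 d)) (\<delta> d)\<rparr>"
  interpret labelled_disk W n \<delta>
    by unfold_locales (use W0 in \<open>simp_all add: W_def potential_lab_update\<close>)
  have len: "length mus = Suc (length lams)" using assms(2) by (simp add: in_P_def)
  have all2: "list_all2 (\<lambda>d f. wt_eq n (\<delta> d) f) (cd W) mus" using W0(4) by (simp add: W_def)
  then have nbd: "nbd W = length lams" using list_all2_lengthD[OF all2] len length_cd by simp
  have at: "wt_eq n (\<delta> (cd W ! i)) (mus ! i)" if "i \<le> nbd W" for i
    using list_all2_nthD[OF all2] that length_cd by simp
  have "wt_list_eq n (associated_path n W) mus"
    unfolding wt_list_eq_def
  proof (intro conjI allI impI)
    show "length (associated_path n W) = length mus" by (simp add: associated_path_def nbd len)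
    fix i assume "i < length (associated_path n W)"
    then have i: "i \<le> nbd W" by (simp add: associated_path_def)
    then have "cd W ! i \<in> inner W" using length_cd by (intro cd_inner) simp
    from wt_eq_trans[OF dist_mark[OF this] at[OF i]] show "wt_eq n (associated_path n W ! i) (mus ! i)"
      using i by (simp add: associated_path_def ext_def nth_append less_Suc_eq_le del: upt_Suc)
  qed
  moreover have "wt_list_eq n (web_boundary n W) lams"
    unfolding wt_list_eq_def
  proof (intro conjI allI impI)
    show "length (web_boundary n W) = length lams" by (simp add: web_boundary_def nbd)
    fix i assume "i < length (web_boundary n W)"
    then have i: "i < nbd W" by (simp add: web_boundary_def)
    have "minuscule_dominant n (lams ! i)" "in_W_orbit n (wt_diff (mus ! Suc i) (mus ! i)) (lams ! i)"
      using assms i nbd by (auto simp: in_P_def)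
    then obtain S where S: "S \<subseteq> {1..n}" "card S < n" "wt_eq n (lams ! i) (omega n (card S))"
      "wt_eq n (mus ! Suc i) (\<lambda>j. (mus ! i) j + ind S j)"
      by (rule minuscule_orbitE)
    have "wt_eq n (\<delta> (cd W ! Suc i)) (mus ! Suc i)" "wt_eq n (mus ! i) (\<delta> (cd W ! i))"
      using at[of "Suc i"] wt_eq_sym[OF at[of i]] i by auto
    then have "wt_eq n (\<delta> (cd W ! Suc i)) (\<lambda>j. \<delta> (cd W ! i) j + ind S j)"
      using S(4) wt_eq_add wt_eq_trans by meson
    then have "lab W (al W (bdart W i)) = card S"
      unfolding lab al_al bdart(4,5)[OF i] by (rule size_mod_eq[OF S(1,2)])
    then show "wt_eq n (web_boundary n W ! i) (lams ! i)"
      using i wt_eq_sym[OF S(3)] by (simp add: web_boundary_def)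
  qed
  ultimately show ?thesis using is_web coherent by blast
qed

end
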